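(* Let $\mathcal{T}=(V,E)$ be a rootless and leafless directed tree and let $S_\lambda$ be a densely defined weighted shift on $\mathcal{T}$ with nonzero weights $\lambda=\{\lambda_v\}_{v\in V}\subseteq\mathbb{C}$. Suppose there exists a system $\{\mu_v\}_{v\in V}$ of Borel probability measures on $\mathbb{R}_+$ such that $$\mu_u(\sigma)=\sum_{v\in\mathrm{Chi}(u)}|\lambda_v|^2\int_\sigma\frac1t\,\mu_v(\mathrm{d}t),\qquad \sigma\in\mathfrak{B}(\mathbb{R}_+),\ u\in V,$$ where $\mathrm{Chi}(u)$ denotes the set of all children of $u$. Then $S_\lambda$ is subnormal.
   Context: A directed tree is a connected directed graph without circuits in which each vertex has at most one parent $\mathrm{par}(v)$; rootless: every vertex has a parent; leafless: every vertex has a child. The weighted shift $S_\lambda$ in $\ell^2(V)$ is defined by $\mathcal{D}(S_\lambda)=\{f\in\ell^2(V):\Lambda f\in\ell^2(V)\}$, $S_\lambda f=\Lambda f$, where $(\Lambda f)(v)=\lambda_v f(\mathrm{par}(v))$ for $v\in V$. Convention $1/0=\infty$, $0\cdot\infty=0$. $\mathbb{R}_+=[0,\infty)$ with Borel $\sigma$-algebra $\mathfrak{B}(\mathbb{R}_+)$. A densely defined operator $S$ in $\mathcal{H}$ is subnormal if there are a Hilbert space $\mathcal{K}\supseteq\mathcal{H}$ and a normal $N$ in $\mathcal{K}$ with $\mathcal{D}(S)\subseteq\mathcal{D}(N)$ and $Sf=Nf$ on $\mathcal{D}(S)$. *)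

theory Defs
  imports "HOL-Probability.Probability"
begin

section \<open>Directed trees (vertex set = UNIV of the vertex type)\<close>

definition directed_tree :: "('a \<times> 'a) set \<Rightarrow> bool" where
  "directed_tree E \<longleftrightarrow>
     (\<forall>u v. (u, v) \<in> (E \<union> E\<inverse>)\<^sup>*) \<and>
     (\<forall>v. (v, v) \<notin> E\<^sup>+) \<and>
     (\<forall>u w v. (u, v) \<in> E \<and> (w, v) \<in> E \<longrightarrow> u = w)"

definition rootless :: "('a \<times> 'a) set \<Rightarrow> bool" where
  "rootless E \<longleftrightarrow> (\<forall>v. \<exists>u. (u, v) \<in> E)"

definition leafless :: "('a \<times> 'a) set \<Rightarrow> bool" where
  "leafless E \<longleftrightarrow> (\<forall>u. \<exists>v. (u, v) \<in> E)"

definition par :: "('a \<times> 'a) set \<Rightarrow> 'a \<Rightarrow> 'a" where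
  "par E v = (THE u. (u, v) \<in> E)"

definition Chi :: "('a \<times> 'a) set \<Rightarrow> 'a \<Rightarrow> 'a set" where
  "Chi E u = {v. (u, v) \<in> E}"

section \<open>The Hilbert space l2(I) of complex functions on a type\<close>

definition l2 :: "('i \<Rightarrow> complex) set" where
  "l2 = {f. (\<lambda>i. (cmod (f i))\<^sup>2) summable_on UNIV}"

definition l2_inner :: "('i \<Rightarrow> complex) \<Rightarrow> ('i \<Rightarrow> complex) \<Rightarrow> complex" where
  "l2_inner f g = (\<Sum>\<^sub>\<infinity>i. f i * cnj (g i))"

definition l2_norm :: "('i \<Rightarrow> complex) \<Rightarrow> real" where
  "l2_norm f = sqrt (\<Sum>\<^sub>\<infinity>i. (cmod (f i))\<^sup>2)"

definition l2_dense :: "('i \<Rightarrow> complex) set \<Rightarrow> bool" where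
  "l2_dense D \<longleftrightarrow> D \<subseteq> l2 \<and>
     (\<forall>f\<in>l2. \<forall>e>0. \<exists>g\<in>D. l2_norm (\<lambda>i. f i - g i) < e)"

section \<open>(Unbounded) operators in l2(I), given as domain + map\<close>

definition l2_subspace :: "('i \<Rightarrow> complex) set \<Rightarrow> bool" where
  "l2_subspace D \<longleftrightarrow> D \<subseteq> l2 \<and> (\<lambda>_. 0) \<in> D \<and>
     (\<forall>f\<in>D. \<forall>g\<in>D. (\<lambda>i. f i + g i) \<in> D) \<and>
     (\<forall>c. \<forall>f\<in>D. (\<lambda>i. c * f i) \<in> D)"

definition op_linear ::
  "('i \<Rightarrow> complex) set \<Rightarrow> (('i \<Rightarrow> complex) \<Rightarrow> ('j \<Rightarrow> complex)) \<Rightarrow> bool" where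
  "op_linear D T \<longleftrightarrow> T ` D \<subseteq> l2 \<and>
     (\<forall>f\<in>D. \<forall>g\<in>D. T (\<lambda>i. f i + g i) = (\<lambda>j. T f j + T g j)) \<and>
     (\<forall>c. \<forall>f\<in>D. T (\<lambda>i. c * f i) = (\<lambda>j. c * T f j))"

definition closed_op ::
  "('i \<Rightarrow> complex) set \<Rightarrow> (('i \<Rightarrow> complex) \<Rightarrow> ('i \<Rightarrow> complex)) \<Rightarrow> bool" where
  "closed_op D T \<longleftrightarrow>
     (\<forall>F f g. (\<forall>n. F n \<in> D) \<and> f \<in> l2 \<and> g \<in> l2 \<and>
        (\<lambda>n. l2_norm (\<lambda>i. F n i - f i)) \<longlonglongrightarrow> 0 \<and>
        (\<lambda>n. l2_norm (\<lambda>i. T (F n) i - g i)) \<longlonglongrightarrow> 0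
        \<longrightarrow> f \<in> D \<and> T f = g)"

definition adj_dom ::
  "('i \<Rightarrow> complex) set \<Rightarrow> (('i \<Rightarrow> complex) \<Rightarrow> ('i \<Rightarrow> complex)) \<Rightarrow> ('i \<Rightarrow> complex) set" where
  "adj_dom D T = {g \<in> l2. \<exists>h\<in>l2. \<forall>f\<in>D. l2_inner (T f) g = l2_inner f h}"

definition adj_op ::
  "('i \<Rightarrow> complex) set \<Rightarrow> (('i \<Rightarrow> complex) \<Rightarrow> ('i \<Rightarrow> complex)) \<Rightarrow> ('i \<Rightarrow> complex) \<Rightarrow> ('i \<Rightarrow> complex)" where
  "adj_op D T g = (THE h. h \<in> l2 \<and> (\<forall>f\<in>D. l2_inner (T f) g = l2_inner f h))"

text \<open>Normal operator: closed, densely defined, and N*N = NN* (equal domains and values).\<close>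
definition normal_op ::
  "('i \<Rightarrow> complex) set \<Rightarrow> (('i \<Rightarrow> complex) \<Rightarrow> ('i \<Rightarrow> complex)) \<Rightarrow> bool" where
  "normal_op D N \<longleftrightarrow> l2_subspace D \<and> op_linear D N \<and> l2_dense D \<and> closed_op D N \<and>
     {f \<in> D. N f \<in> adj_dom D N} = {g \<in> adj_dom D N. adj_op D N g \<in> D} \<and>
     (\<forall>f\<in>D. N f \<in> adj_dom D N \<longrightarrow> adj_op D N (N f) = N (adj_op D N f))"

text \<open>Subnormality of a densely defined operator (D,S) in l2('a): there is a Hilbert space K
  containing l2('a) isometrically (here K = l2('a \<times> nat), see NOTES) and a normal N in K
  extending S.\<close>
definition subnormal ::
  "('a \<Rightarrow> complex) set \<Rightarrow> (('a \<Rightarrow> complex) \<Rightarrow> ('a \<Rightarrow> complex)) \<Rightarrow> bool" where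
  "subnormal D S \<longleftrightarrow> l2_dense D \<and>
     (\<exists>(J :: ('a \<Rightarrow> complex) \<Rightarrow> ('a \<times> nat \<Rightarrow> complex)) DN N.
        op_linear l2 J \<and> (\<forall>f\<in>l2. l2_norm (J f) = l2_norm f) \<and>
        normal_op DN N \<and> J ` D \<subseteq> DN \<and> (\<forall>f\<in>D. N (J f) = J (S f)))"

section \<open>Weighted shifts on a rootless directed tree\<close>

definition shift_dom :: "('a \<times> 'a) set \<Rightarrow> ('a \<Rightarrow> complex) \<Rightarrow> ('a \<Rightarrow> complex) set" where
  "shift_dom E lam = {f \<in> l2. (\<lambda>v. lam v * f (par E v)) \<in> l2}"

definition shift_op :: "('a \<times> 'a) set \<Rightarrow> ('a \<Rightarrow> complex) \<Rightarrow> ('a \<Rightarrow> complex) \<Rightarrow> ('a \<Rightarrow> complex)" where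
  "shift_op E lam f = (\<lambda>v. lam v * f (par E v))"

end

theory Submission
  imports Defs
begin

text \<open>
  On \<open>K = \<Oplus>\<^sub>v L\<^sup>2(\<mu>\<^sub>v)\<close>, which contains \<open>l2(V)\<close> as the functions constant in \<open>t\<close>, the consistency
  condition says that \<open>(U f)(v, t) = \<lambda>\<^sub>v t\<^sup>-\<^sup>1\<^sup>/\<^sup>2 f(par v, t)\<close> is an isometry. It commutes with
  multiplication by functions of \<open>t\<close>, and \<open>f(v, t) \<mapsto> \<lambda>\<^sub>v f(par v, t) = U (sqrt t f)\<close> extends the shift.
  Replacing \<open>U\<close> by its unitary Halmos dilation \<open>W\<close> on \<open>K \<oplus> K\<close> gives the normal extension
  \<open>N = W sqrt t\<close>. It is written as a quotient of the commuting bounded operators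
  \<open>W sqrt (t / (1 + t))\<close> and \<open>1 / sqrt (1 + t)\<close>.

  Orthonormal systems of the fibres, obtained by Gram-Schmidt from the indicators of a countable
  generating \<open>\<pi>\<close>-system, carry these operators over to \<open>l2(V \<times> nat)\<close>.
\<close>

section \<open>The Hilbert space of square-summable functions\<close>

lemma l2_iff_nn:
  fixes f :: "'i \<Rightarrow> complex"
  shows "f \<in> l2 \<longleftrightarrow> (\<integral>\<^sup>+ i. ennreal ((cmod (f i))\<^sup>2) \<partial>count_space UNIV) < \<infinity>"
proof -
  have "f \<in> l2 \<longleftrightarrow> Infinite_Set_Sum.abs_summable_on (\<lambda>i. (cmod (f i))\<^sup>2) UNIV"
    unfolding l2_def abs_summable_equivalent[symmetric] by simp
  then show ?thesis
    by (simp add: abs_summable_on_def integrable_iff_bounded)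
qed

lemma l2_norm_nn:
  fixes f :: "'i \<Rightarrow> complex"
  assumes "f \<in> l2"
  shows "ennreal ((l2_norm f)\<^sup>2) = (\<integral>\<^sup>+ i. ennreal ((cmod (f i))\<^sup>2) \<partial>count_space UNIV)"
proof -
  have s: "Infinite_Set_Sum.abs_summable_on (\<lambda>i. (cmod (f i))\<^sup>2) UNIV"
    using assms unfolding l2_def abs_summable_equivalent[symmetric] by simp
  have "(\<integral>\<^sup>+ i. ennreal ((cmod (f i))\<^sup>2) \<partial>count_space UNIV) =
      ennreal (infsetsum (\<lambda>i. (cmod (f i))\<^sup>2) UNIV)"
    by (rule nn_integral_conv_infsetsum[OF s]) simp
  also have "infsetsum (\<lambda>i. (cmod (f i))\<^sup>2) UNIV = (\<Sum>\<^sub>\<infinity>i. (cmod (f i))\<^sup>2)"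
    by (rule infsetsum_infsum[OF s])
  finally show ?thesis
    by (simp add: l2_norm_def infsum_nonneg)
qed

lemma l2_norm_nonneg [simp]: "l2_norm f \<ge> 0"
  by (simp add: l2_norm_def infsum_nonneg)

lemma l2_inner_abs_summable:
  assumes "f \<in> l2" "g \<in> l2"
  shows "(\<lambda>i. cmod (f i * cnj (g i))) summable_on UNIV"
proof (rule summable_on_comparison_test)
  show "(\<lambda>i. (cmod (f i))\<^sup>2 + (cmod (g i))\<^sup>2) summable_on UNIV"
    using assms by (intro summable_on_add) (auto simp: l2_def)
  show "cmod (f i * cnj (g i)) \<le> (cmod (f i))\<^sup>2 + (cmod (g i))\<^sup>2" for i
  proof -
    have "0 \<le> (cmod (f i) - cmod (g i))\<^sup>2" by simp
    then have "2 * (cmod (f i) * cmod (g i)) \<le> (cmod (f i))\<^sup>2 + (cmod (g i))\<^sup>2"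
      by (simp add: power2_diff)
    moreover have "0 \<le> cmod (f i) * cmod (g i)" by simp
    ultimately show ?thesis unfolding norm_mult complex_mod_cnj by linarith
  qed
qed auto

lemma l2_inner_summable:
  assumes "f \<in> l2" "g \<in> l2"
  shows "(\<lambda>i. f i * cnj (g i)) summable_on UNIV"
  by (rule abs_summable_summable[OF l2_inner_abs_summable[OF assms]])

lemma l2_zero [simp]: "(\<lambda>_. 0) \<in> l2"
  by (simp add: l2_def)

lemma l2_scale [simp]: "f \<in> l2 \<Longrightarrow> (\<lambda>i. c * f i) \<in> l2"
  unfolding l2_def by (simp add: norm_mult power_mult_distrib summable_on_cmult_right)

lemma cmod_add_squared_le: "(cmod (a + b))\<^sup>2 \<le> 2 * (cmod a)\<^sup>2 + 2 * (cmod b)\<^sup>2"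
proof -
  have "(cmod (a + b))\<^sup>2 \<le> (cmod a + cmod b)\<^sup>2"
    by (intro power_mono norm_triangle_ineq) simp
  also have "\<dots> \<le> 2 * (cmod a)\<^sup>2 + 2 * (cmod b)\<^sup>2"
    using zero_le_power2[of "cmod a - cmod b"] by (simp add: power2_diff power2_sum)
  finally show ?thesis .
qed

lemma l2_add [simp]:
  assumes "f \<in> l2" "g \<in> l2"
  shows "(\<lambda>i. f i + g i) \<in> l2"
  unfolding l2_def mem_Collect_eq
proof (rule summable_on_comparison_test)
  show "(\<lambda>i. 2 * (cmod (f i))\<^sup>2 + 2 * (cmod (g i))\<^sup>2) summable_on UNIV"
    using assms by (intro summable_on_add summable_on_cmult_right) (auto simp: l2_def)
  show "(cmod (f i + g i))\<^sup>2 \<le> 2 * (cmod (f i))\<^sup>2 + 2 * (cmod (g i))\<^sup>2" for i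
    by (rule cmod_add_squared_le)
qed auto

lemma l2_diff [simp]:
  assumes "f \<in> l2" "g \<in> l2"
  shows "(\<lambda>i. f i - g i) \<in> l2"
  using l2_add[OF assms(1) l2_scale[OF assms(2), of "-1"]] by simp

lemma l2_inner_add_left:
  assumes "f \<in> l2" "g \<in> l2" "h \<in> l2"
  shows "l2_inner (\<lambda>i. f i + g i) h = l2_inner f h + l2_inner g h"
  unfolding l2_inner_def distrib_right
  by (intro infsum_add l2_inner_summable assms)

lemma l2_inner_scale_left: "l2_inner (\<lambda>i. c * f i) g = c * l2_inner f g"
  unfolding l2_inner_def mult.assoc by (rule infsum_cmult_right')

lemma l2_inner_diff_left:
  assumes "f \<in> l2" "g \<in> l2" "h \<in> l2"
  shows "l2_inner (\<lambda>i. f i - g i) h = l2_inner f h - l2_inner g h"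
  using l2_inner_add_left[OF assms(1) l2_scale[OF assms(2), of "-1"] assms(3)]
  by (simp only: l2_inner_scale_left) simp

lemma l2_inner_cnj: "cnj (l2_inner f g) = l2_inner g f"
  unfolding l2_inner_def infsum_cnj[symmetric] by (simp add: mult.commute)

lemma l2_inner_add_right:
  assumes "f \<in> l2" "g \<in> l2" "h \<in> l2"
  shows "l2_inner f (\<lambda>i. g i + h i) = l2_inner f g + l2_inner f h"
  by (metis (no_types) assms complex_cnj_add l2_inner_add_left l2_inner_cnj)

lemma l2_inner_diff_right:
  assumes "f \<in> l2" "g \<in> l2" "h \<in> l2"
  shows "l2_inner f (\<lambda>i. g i - h i) = l2_inner f g - l2_inner f h"
  by (metis (no_types) assms complex_cnj_diff l2_inner_diff_left l2_inner_cnj)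

lemma l2_inner_scale_right: "l2_inner f (\<lambda>i. c * g i) = cnj c * l2_inner f g"
  by (metis (no_types) complex_cnj_mult l2_inner_scale_left l2_inner_cnj)

lemma l2_inner_self: "l2_inner f f = of_real ((l2_norm f)\<^sup>2)"
proof -
  have "l2_inner f f = (\<Sum>\<^sub>\<infinity>i. complex_of_real ((cmod (f i))\<^sup>2))"
    unfolding l2_inner_def complex_norm_square ..
  also have "\<dots> = of_real (\<Sum>\<^sub>\<infinity>i. (cmod (f i))\<^sup>2)"
  proof (cases "(\<lambda>i. (cmod (f i))\<^sup>2) summable_on UNIV")
    case True
    then show ?thesis by (intro infsumI has_sum_of_real has_sum_infsum)
  next
    case False
    then have "\<not> (\<lambda>i. complex_of_real ((cmod (f i))\<^sup>2)) summable_on UNIV"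
      using summable_on_Re by fastforce
    with False show ?thesis by (simp add: infsum_not_exists)
  qed
  finally show ?thesis by (simp add: l2_norm_def infsum_nonneg)
qed

lemma l2_norm_eq_0:
  assumes "f \<in> l2" "l2_norm f = 0"
  shows "f = (\<lambda>_. 0)"
proof
  fix i
  have "(\<Sum>\<^sub>\<infinity>i. (cmod (f i))\<^sup>2) \<le> 0" using assms by (simp add: l2_norm_def)
  then have "(cmod (f i))\<^sup>2 = 0"
    by (rule nonneg_infsum_le_0D) (use assms in \<open>auto simp: l2_def\<close>)
  then show "f i = 0" by simp
qed

lemma l2_inner_eqI:
  assumes "f \<in> l2" "g \<in> l2" "\<And>h. h \<in> l2 \<Longrightarrow> l2_inner f h = l2_inner g h"
  shows "f = g"
proof -
  have d: "(\<lambda>i. f i - g i) \<in> l2" using assms by simp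
  have "l2_inner (\<lambda>i. f i - g i) (\<lambda>i. f i - g i) = 0"
    using assms d by (subst l2_inner_diff_left) auto
  then have "l2_norm (\<lambda>i. f i - g i) = 0" by (simp add: l2_inner_self)
  from l2_norm_eq_0[OF d this] show ?thesis by (metis ext eq_iff_diff_eq_0)
qed

lemma l2_norm_scale: "l2_norm (\<lambda>i. c * f i) = cmod c * l2_norm f"
  by (simp add: l2_norm_def norm_mult power_mult_distrib infsum_cmult_right' real_sqrt_mult)

lemma l2_norm_add_sq:
  assumes "f \<in> l2" "g \<in> l2"
  shows "(l2_norm (\<lambda>i. f i + g i))\<^sup>2 = (l2_norm f)\<^sup>2 + (l2_norm g)\<^sup>2 + 2 * Re (l2_inner f g)"
proof -
  have "complex_of_real ((l2_norm (\<lambda>i. f i + g i))\<^sup>2) =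
      l2_inner f f + l2_inner f g + (l2_inner g f + l2_inner g g)"
    unfolding l2_inner_self[symmetric] using assms
    by (simp add: l2_inner_add_left l2_inner_add_right)
  from arg_cong[OF this, of Re] show ?thesis
    by (simp add: l2_inner_self l2_inner_cnj[of f g, symmetric])
qed

lemma Re_l2_inner_le:
  assumes "f \<in> l2" "g \<in> l2"
  shows "2 * Re (l2_inner f g) \<le> (l2_norm f)\<^sup>2 + (l2_norm g)\<^sup>2"
proof -
  have "0 \<le> (l2_norm (\<lambda>i. f i + -1 * g i))\<^sup>2" by simp
  also have "\<dots> = (l2_norm f)\<^sup>2 + (l2_norm g)\<^sup>2 - 2 * Re (l2_inner f g)"
    using l2_norm_add_sq[OF assms(1) l2_scale[OF assms(2), of "-1"]]
    by (simp only: l2_norm_scale l2_inner_scale_right) simp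
  finally show ?thesis by simp
qed

lemma l2_Cauchy_Schwarz:
  assumes "f \<in> l2" "g \<in> l2"
  shows "cmod (l2_inner f g) \<le> l2_norm f * l2_norm g"
proof (cases "l2_norm f = 0 \<or> l2_norm g = 0")
  case True
  then have "f = (\<lambda>_. 0) \<or> g = (\<lambda>_. 0)" using assms l2_norm_eq_0 by blast
  then show ?thesis by (auto simp: l2_inner_def)
next
  case False
  define a where "a = l2_norm f"
  define b where "b = l2_norm g"
  have pos: "a > 0" "b > 0" using False unfolding a_def b_def
    by (auto simp: less_le)
  define z where "z = l2_inner f g"
  define c where "c = cnj (sgn z) / of_real a"
  have "2 * Re (l2_inner (\<lambda>i. c * f i) (\<lambda>i. of_real (1 / b) * g i)) \<le>
      (l2_norm (\<lambda>i. c * f i))\<^sup>2 + (l2_norm (\<lambda>i. of_real (1 / b) * g i))\<^sup>2"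
    by (intro Re_l2_inner_le l2_scale assms)
  also have "(l2_norm (\<lambda>i. of_real (1 / b) * g i))\<^sup>2 = 1"
    unfolding l2_norm_scale b_def[symmetric] using pos by (simp add: norm_divide)
  also have "(l2_norm (\<lambda>i. c * f i))\<^sup>2 \<le> 1"
    unfolding l2_norm_scale a_def[symmetric] c_def using pos by (simp add: norm_divide norm_sgn)
  also have "l2_inner (\<lambda>i. c * f i) (\<lambda>i. of_real (1 / b) * g i) = cnj (sgn z) * z / (a * b)"
    unfolding l2_inner_scale_left l2_inner_scale_right z_def[symmetric] c_def using pos
    by (simp add: field_simps)
  also have "cnj (sgn z) * z = of_real (cmod z)"
    by (cases "z = 0") (simp_all add: sgn_div_norm complex_norm_square[symmetric] scaleR_conv_of_real
        power2_eq_square mult.commute[of "cnj z"] field_simps)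
  finally have "cmod z / (a * b) \<le> 1" by (simp flip: of_real_mult of_real_divide)
  then show ?thesis using pos unfolding z_def a_def b_def by (simp add: field_simps)
qed

lemma l2_inner_polar:
  fixes f g :: "'i \<Rightarrow> complex" and f' g' :: "'j \<Rightarrow> complex"
  assumes "f \<in> l2" "g \<in> l2" "f' \<in> l2" "g' \<in> l2"
    and "\<And>c. l2_norm (\<lambda>i. f i + c * g i) = l2_norm (\<lambda>i. f' i + c * g' i)"
    and "l2_norm f = l2_norm f'" "l2_norm g = l2_norm g'"
  shows "l2_inner f g = l2_inner f' g'"
proof -
  have "Re (cnj c * l2_inner f g) = Re (cnj c * l2_inner f' g')" for c
    using l2_norm_add_sq[OF assms(1) l2_scale[OF assms(2), of c]]
      l2_norm_add_sq[OF assms(3) l2_scale[OF assms(4), of c]] assms(5)[of c] assms(6,7)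
    by (simp add: l2_inner_scale_right l2_norm_scale)
  from this[of 1] this[of \<i>] show ?thesis by (simp add: complex_eq_iff)
qed

section \<open>Normal quotients of bounded operators\<close>

definition adjoint_pair ::
  "(('i \<Rightarrow> complex) \<Rightarrow> ('i \<Rightarrow> complex)) \<Rightarrow> (('i \<Rightarrow> complex) \<Rightarrow> ('i \<Rightarrow> complex)) \<Rightarrow> bool" where
  "adjoint_pair T T' \<longleftrightarrow> (\<forall>f\<in>l2. T f \<in> l2) \<and> (\<forall>f\<in>l2. T' f \<in> l2) \<and>
     (\<forall>f\<in>l2. \<forall>g\<in>l2. l2_inner (T f) g = l2_inner f (T' g))"

lemma adjoint_pairD:
  assumes "adjoint_pair T T'"
  shows "f \<in> l2 \<Longrightarrow> T f \<in> l2" "f \<in> l2 \<Longrightarrow> T' f \<in> l2"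
    "f \<in> l2 \<Longrightarrow> g \<in> l2 \<Longrightarrow> l2_inner (T f) g = l2_inner f (T' g)"
  using assms unfolding adjoint_pair_def by auto

lemma adjoint_pair_sym: "adjoint_pair T T' \<Longrightarrow> adjoint_pair T' T"
  unfolding adjoint_pair_def by (metis l2_inner_cnj)

lemma adjoint_pair_add:
  assumes "adjoint_pair T T'" "f \<in> l2" "g \<in> l2"
  shows "T (\<lambda>i. f i + g i) = (\<lambda>i. T f i + T g i)"
  by (rule l2_inner_eqI)
    (simp_all add: assms adjoint_pairD[OF assms(1)] l2_inner_add_left)

lemma adjoint_pair_diff:
  assumes "adjoint_pair T T'" "f \<in> l2" "g \<in> l2"
  shows "T (\<lambda>i. f i - g i) = (\<lambda>i. T f i - T g i)"
  by (rule l2_inner_eqI)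
    (simp_all add: assms adjoint_pairD[OF assms(1)] l2_inner_diff_left)

lemma adjoint_pair_scale:
  assumes "adjoint_pair T T'" "f \<in> l2"
  shows "T (\<lambda>i. c * f i) = (\<lambda>i. c * T f i)"
  by (rule l2_inner_eqI)
    (simp_all add: assms adjoint_pairD[OF assms(1)] l2_inner_scale_left)

lemma adjoint_pair_commute:
  assumes T: "adjoint_pair T T'" and S: "adjoint_pair S S'"
    and c: "\<And>f. f \<in> l2 \<Longrightarrow> T (S f) = S (T f)" and f: "f \<in> l2"
  shows "T' (S' f) = S' (T' f)"
proof (rule l2_inner_eqI)
  note D = adjoint_pairD[OF T] adjoint_pairD[OF S]
  note D' = adjoint_pairD(3)[OF adjoint_pair_sym[OF T]] adjoint_pairD(3)[OF adjoint_pair_sym[OF S]]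
  show "T' (S' f) \<in> l2" "S' (T' f) \<in> l2" using f D by auto
  show "l2_inner (T' (S' f)) h = l2_inner (S' (T' f)) h" if "h \<in> l2" for h
    using f that c by (simp add: D D')
qed

lemma adjoint_pair_comp:
  assumes "adjoint_pair T T'" "adjoint_pair S S'"
  shows "adjoint_pair (\<lambda>f. T (S f)) (\<lambda>f. S' (T' f))"
  using assms unfolding adjoint_pair_def by simp

lemma l2_inner_tendsto:
  assumes F: "\<And>n. F n \<in> l2" and f: "f \<in> l2" and h: "h \<in> l2"
    and lim: "(\<lambda>n. l2_norm (\<lambda>i. F n i - f i)) \<longlonglongrightarrow> 0"
  shows "(\<lambda>n. l2_inner (F n) h) \<longlonglongrightarrow> l2_inner f h"
proof (rule LIM_zero_cancel, rule tendsto_0_le[where K = 1])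
  show "(\<lambda>n. l2_norm (\<lambda>i. F n i - f i) * l2_norm h) \<longlonglongrightarrow> 0"
    using tendsto_mult_right[OF lim, of "l2_norm h"] by simp
  have "cmod (l2_inner (F n) h - l2_inner f h) \<le> l2_norm (\<lambda>i. F n i - f i) * l2_norm h" for n
    using l2_Cauchy_Schwarz[of "\<lambda>i. F n i - f i" h] F f h by (simp add: l2_inner_diff_left)
  then show "\<forall>\<^sub>F n in sequentially. cmod (l2_inner (F n) h - l2_inner f h)
      \<le> norm (l2_norm (\<lambda>i. F n i - f i) * l2_norm h) * 1" by simp
qed

lemma l2_dense_orthogonal:
  assumes "l2_dense D" "g \<in> l2" "\<And>f. f \<in> D \<Longrightarrow> l2_inner f g = 0"
  shows "g = (\<lambda>_. 0)"
proof (rule l2_norm_eq_0[OF assms(2)], rule ccontr)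
  assume "l2_norm g \<noteq> 0"
  then have pos: "l2_norm g > 0" by (simp add: less_le)
  then obtain f where f: "f \<in> D" "l2_norm (\<lambda>i. g i - f i) < l2_norm g"
    using assms(1,2) unfolding l2_dense_def by metis
  have "f \<in> l2" using assms(1) f(1) unfolding l2_dense_def by blast
  then have "l2_inner (\<lambda>i. g i - f i) g = of_real ((l2_norm g)\<^sup>2)"
    using assms f by (simp add: l2_inner_diff_left l2_inner_self)
  then have "(l2_norm g)\<^sup>2 \<le> l2_norm (\<lambda>i. g i - f i) * l2_norm g"
    using l2_Cauchy_Schwarz[of "\<lambda>i. g i - f i" g] \<open>f \<in> l2\<close> assms(2) by (simp add: norm_power)
  then show False using f(2) pos by (simp add: power2_eq_square)
qed

lemma adj_op_eqI:
  assumes "l2_dense D" "op_linear D T" "g \<in> l2" "h \<in> l2"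
    "\<And>f. f \<in> D \<Longrightarrow> l2_inner (T f) g = l2_inner f h"
  shows "g \<in> adj_dom D T" "adj_op D T g = h"
proof -
  show "g \<in> adj_dom D T" unfolding adj_dom_def using assms by blast
  show "adj_op D T g = h" unfolding adj_op_def
  proof (rule the_equality)
    fix h' assume h': "h' \<in> l2 \<and> (\<forall>f\<in>D. l2_inner (T f) g = l2_inner f h')"
    have "(\<lambda>i. h' i - h i) = (\<lambda>_. 0)"
    proof (rule l2_dense_orthogonal[OF assms(1)])
      fix f assume "f \<in> D"
      moreover then have "f \<in> l2" using assms(1) unfolding l2_dense_def by blast
      ultimately show "l2_inner f (\<lambda>i. h' i - h i) = 0"
        using h' assms by (simp add: l2_inner_diff_right)
    qed (use h' assms in simp)
    then show "h' = h" by (metis ext eq_iff_diff_eq_0)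
  qed (use assms in blast)
qed

lemma normal_op_quotient:
  assumes B: "adjoint_pair B B'" and C: "adjoint_pair C C"
    and BC: "\<And>f. f \<in> l2 \<Longrightarrow> B (C f) = C (B f)"
    and BB1: "\<And>f. f \<in> l2 \<Longrightarrow> (\<lambda>i. C (C f) i + B' (B f) i) = f"
    and BB2: "\<And>f. f \<in> l2 \<Longrightarrow> (\<lambda>i. C (C f) i + B (B' f) i) = f"
    and dense: "l2_dense (C ` l2)"
  obtains N where "normal_op (C ` l2) N" "\<And>x. x \<in> l2 \<Longrightarrow> N (C x) = B x"
proof -
  note BD = adjoint_pairD[OF B] and CD = adjoint_pairD[OF C]
  note B' = adjoint_pair_sym[OF B]
  note BD' = adjoint_pairD[OF B']
  have B'C: "B' (C f) = C (B' f)" if "f \<in> l2" for f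
    by (rule adjoint_pair_commute[OF B C BC that])
  have inj: "inj_on C l2"
  proof (rule inj_onI)
    fix x y assume xy: "x \<in> l2" "y \<in> l2" "C x = C y"
    have "(\<lambda>i. x i - y i) = (\<lambda>_. 0)"
    proof (rule l2_dense_orthogonal[OF dense])
      fix f assume "f \<in> C ` l2"
      then obtain g where "g \<in> l2" "f = C g" by blast
      then show "l2_inner f (\<lambda>i. x i - y i) = 0"
        using xy by (simp add: CD l2_inner_diff_right adjoint_pair_diff[OF C])
    qed (use xy in simp)
    then show "x = y" by (metis ext eq_iff_diff_eq_0)
  qed
  define N where "N g = B (inv_into l2 C g)" for g
  have N: "N (C x) = B x" if "x \<in> l2" for x
    unfolding N_def by (simp add: inv_into_f_f[OF inj that])
  define D where "D = C ` l2"
  have lin: "op_linear D N"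
    unfolding op_linear_def D_def
    by (auto simp: N BD adjoint_pair_add[OF C, symmetric] adjoint_pair_scale[OF C, symmetric]
        adjoint_pair_add[OF B] adjoint_pair_scale[OF B])
  have zero: "(\<lambda>_. 0) \<in> D"
    using adjoint_pair_scale[OF C l2_zero, of 0] unfolding D_def by (auto simp: image_iff intro!: bexI[of _ "\<lambda>_. 0"])
  have sub: "l2_subspace D"
    unfolding l2_subspace_def using zero
    by (auto simp: D_def CD adjoint_pair_add[OF C, symmetric] adjoint_pair_scale[OF C, symmetric])
  have closed: "closed_op D N"
    unfolding closed_op_def
  proof (intro allI impI)
    fix F f g
    assume "(\<forall>n. F n \<in> D) \<and> f \<in> l2 \<and> g \<in> l2 \<and>
        (\<lambda>n. l2_norm (\<lambda>i. F n i - f i)) \<longlonglongrightarrow> 0 \<and> (\<lambda>n. l2_norm (\<lambda>i. N (F n) i - g i)) \<longlonglongrightarrow> 0"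
    then have FD: "\<forall>n. \<exists>x\<in>l2. F n = C x" and fg: "f \<in> l2" "g \<in> l2"
      and l1: "(\<lambda>n. l2_norm (\<lambda>i. F n i - f i)) \<longlonglongrightarrow> 0"
      and l2: "(\<lambda>n. l2_norm (\<lambda>i. N (F n) i - g i)) \<longlonglongrightarrow> 0"
      by (auto simp: D_def image_iff)
    from FD obtain x where x: "\<And>n. x n \<in> l2" "\<And>n. F n = C (x n)" by metis
    have NF: "N (F n) = B (x n)" for n by (simp add: x N)
    have i1: "(\<lambda>n. l2_inner (C (x n)) h) \<longlonglongrightarrow> l2_inner f h"
      and i2: "(\<lambda>n. l2_inner (B (x n)) h) \<longlonglongrightarrow> l2_inner g h" if "h \<in> l2" for h
      using l2_inner_tendsto[OF _ fg(1) that l1] l2_inner_tendsto[OF _ fg(2) that l2[unfolded NF]] x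
      by (auto simp: NF CD BD)
    define y where "y i = C f i + B' g i" for i
    have y: "y \<in> l2" using fg unfolding y_def[abs_def] by (simp add: CD BD)
    have x_lim: "(\<lambda>n. l2_inner (x n) h) \<longlonglongrightarrow> l2_inner y h" if h: "h \<in> l2" for h
    proof -
      have "l2_inner (x n) h = l2_inner (C (x n)) (C h) + l2_inner (B (x n)) (B h)" for n
      proof -
        have "l2_inner (x n) h = l2_inner (\<lambda>i. C (C (x n)) i + B' (B (x n)) i) h"
          by (simp add: BB1 x)
        then show ?thesis using x h by (simp add: l2_inner_add_left CD BD BD')
      qed
      moreover have "(\<lambda>n. l2_inner (C (x n)) (C h) + l2_inner (B (x n)) (B h)) \<longlonglongrightarrow>
          l2_inner f (C h) + l2_inner g (B h)"
        using h by (intro tendsto_add i1 i2) (auto simp: CD BD)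
      moreover have "l2_inner f (C h) + l2_inner g (B h) = l2_inner y h"
        unfolding y_def using fg h by (simp add: l2_inner_add_left CD BD BD')
      ultimately show ?thesis by simp
    qed
    have "C y = f"
    proof (rule l2_inner_eqI)
      fix h :: "'a \<Rightarrow> complex" assume h: "h \<in> l2"
      have "(\<lambda>n. l2_inner (C (x n)) h) \<longlonglongrightarrow> l2_inner (C y) h"
        using x_lim[of "C h"] x y h by (simp add: CD)
      from LIMSEQ_unique[OF this i1[OF h]] show "l2_inner (C y) h = l2_inner f h" .
    qed (use y fg in \<open>simp_all add: CD\<close>)
    moreover have "B y = g"
    proof (rule l2_inner_eqI)
      fix h :: "'a \<Rightarrow> complex" assume h: "h \<in> l2"
      have "(\<lambda>n. l2_inner (B (x n)) h) \<longlonglongrightarrow> l2_inner (B y) h"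
        using x_lim[of "B' h"] x y h by (simp add: BD)
      from LIMSEQ_unique[OF this i2[OF h]] show "l2_inner (B y) h = l2_inner g h" .
    qed (use y fg in \<open>simp_all add: BD\<close>)
    ultimately show "f \<in> D \<and> N f = g" using y N[OF y] unfolding D_def by blast
  qed
  have adj: "C x \<in> adj_dom D N" "adj_op D N (C x) = B' x" if x: "x \<in> l2" for x
  proof -
    have "l2_inner (N f) (C x) = l2_inner f (B' x)" if fD: "f \<in> D" for f
    proof -
      obtain z where "z \<in> l2" "f = C z" using fD unfolding D_def by blast
      then show ?thesis using x by (simp add: N CD BD B'C)
    qed
    then show "C x \<in> adj_dom D N" "adj_op D N (C x) = B' x"
      using adj_op_eqI[of D N "C x" "B' x"] dense lin x by (auto simp: D_def CD BD)
  qed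
  have ranC: "\<exists>y\<in>l2. f = C y" if f: "f \<in> l2" and h: "h \<in> l2" and eq: "B f = C h \<or> B' f = C h" for f h
  proof -
    from eq consider "B f = C h" | "B' f = C h" by blast
    then show ?thesis
    proof cases
      case 1
      have "f = (\<lambda>i. C (C f) i + C (B' h) i)" using BB1[OF f] by (simp add: 1 B'C[OF h])
      also have "\<dots> = C (\<lambda>i. C f i + B' h i)"
        using f h by (simp add: adjoint_pair_add[OF C] CD BD)
      finally show ?thesis using f h by (intro bexI[of _ "\<lambda>i. C f i + B' h i"]) (simp_all add: CD BD)
    next
      case 2
      have "f = (\<lambda>i. C (C f) i + C (B h) i)" using BB2[OF f] by (simp add: 2 BC[OF h])
      also have "\<dots> = C (\<lambda>i. C f i + B h i)"
        using f h by (simp add: adjoint_pair_add[OF C] CD BD)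
      finally show ?thesis using f h by (intro bexI[of _ "\<lambda>i. C f i + B h i"]) (simp_all add: CD BD)
    qed
  qed
  have adjD: "adj_dom D N = D"
  proof
    show "D \<subseteq> adj_dom D N" using adj(1) unfolding D_def by blast
    show "adj_dom D N \<subseteq> D"
    proof
      fix g assume "g \<in> adj_dom D N"
      then obtain h where g: "g \<in> l2" and h: "h \<in> l2"
        and eq: "\<And>f. f \<in> D \<Longrightarrow> l2_inner (N f) g = l2_inner f h"
        unfolding adj_dom_def by blast
      have "B' g = C h"
      proof (rule l2_inner_eqI)
        fix x :: "'a \<Rightarrow> complex" assume x: "x \<in> l2"
        have "l2_inner x (B' g) = l2_inner x (C h)"
          using eq[of "C x"] x g h by (simp add: N D_def BD CD)
        then show "l2_inner (B' g) x = l2_inner (C h) x" by (metis l2_inner_cnj)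
      qed (use g h in \<open>simp_all add: BD CD\<close>)
      then show "g \<in> D" using ranC[OF g h] unfolding D_def by blast
    qed
  qed
  have BD_iff: "B x \<in> D \<longleftrightarrow> B' x \<in> D" if x: "x \<in> l2" for x
  proof -
    have "B' x \<in> D \<and> B x \<in> D" if BB: "B x \<in> D \<or> B' x \<in> D"
    proof -
      obtain y where y: "y \<in> l2" "x = C y" using BB ranC[OF x] unfolding D_def by blast
      then have "B' x = C (B' y)" "B x = C (B y)" by (simp_all add: B'C BC)
      then show ?thesis using y unfolding D_def by (simp add: BD)
    qed
    then show ?thesis by blast
  qed
  have "N f \<in> D \<longleftrightarrow> adj_op D N f \<in> D" if fD: "f \<in> D" for f
  proof -
    obtain x where "x \<in> l2" "f = C x" using fD unfolding D_def by blast
    then show ?thesis by (simp add: N adj(2) BD_iff)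
  qed
  then have "{f \<in> D. N f \<in> adj_dom D N} = {g \<in> adj_dom D N. adj_op D N g \<in> D}"
    unfolding adjD by blast
  moreover have "adj_op D N (N f) = N (adj_op D N f)" if f: "f \<in> D" "N f \<in> adj_dom D N" for f
  proof -
    obtain x where x: "x \<in> l2" "f = C x" using f(1) unfolding D_def by blast
    then have "B x \<in> D" using f(2) unfolding adjD by (simp add: N)
    then obtain h where h: "h \<in> l2" "B x = C h" unfolding D_def by blast
    obtain y where y: "y \<in> l2" "x = C y" using ranC[OF x(1) h(1)] h(2) by blast
    have "B' (B y) = B (B' y)"
    proof
      fix i
      show "B' (B y) i = B (B' y) i"
        using fun_cong[OF BB1[OF y(1)], of i] fun_cong[OF BB2[OF y(1)], of i] by (metis add_left_cancel)
    qed
    then show ?thesis using y x(2)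
      by (simp add: N adj(2) BC B'C CD BD)
  qed
  ultimately have "normal_op D N"
    unfolding normal_op_def using sub lin dense closed unfolding D_def by blast
  then show ?thesis using that N unfolding D_def by blast
qed

section \<open>Adjoints and the dilation of an isometry\<close>

lemma l2_finite_support:
  assumes "finite F"
  shows "(\<lambda>i. if i \<in> F then f i else 0) \<in> l2"
    and "(l2_norm (\<lambda>i. if i \<in> F then f i else 0))\<^sup>2 = (\<Sum>i\<in>F. (cmod (f i))\<^sup>2)"
proof -
  have "((\<lambda>i. (cmod (if i \<in> F then f i else 0))\<^sup>2) has_sum (\<Sum>i\<in>F. (cmod (f i))\<^sup>2)) UNIV"
    by (rule has_sum_finite_neutralI[OF assms]) auto
  then show "(\<lambda>i. if i \<in> F then f i else 0) \<in> l2"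
    "(l2_norm (\<lambda>i. if i \<in> F then f i else 0))\<^sup>2 = (\<Sum>i\<in>F. (cmod (f i))\<^sup>2)"
    by (auto simp: l2_def l2_norm_def infsumI sum_nonneg has_sum_imp_summable)
qed

lemma l2_finite_approx:
  assumes f: "f \<in> l2"
  shows "((\<lambda>F. l2_norm (\<lambda>i. f i - (if i \<in> F then f i else 0))) \<longlongrightarrow> 0) (finite_subsets_at_top UNIV)"
proof -
  define r where "r F i = (if i \<in> F then f i else 0)" for F i
  define s where "s = (\<Sum>\<^sub>\<infinity>i. (cmod (f i))\<^sup>2)"
  have s: "(l2_norm f)\<^sup>2 = s" unfolding s_def l2_norm_def by (simp add: infsum_nonneg)
  have "(l2_norm (\<lambda>i. f i - r F i))\<^sup>2 = s - (\<Sum>i\<in>F. (cmod (f i))\<^sup>2)" if F: "finite F" for F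
  proof -
    have r: "r F \<in> l2" "(l2_norm (r F))\<^sup>2 = (\<Sum>i\<in>F. (cmod (f i))\<^sup>2)"
      unfolding r_def[abs_def] by (rule l2_finite_support[OF F])+
    have "l2_inner (\<lambda>i. f i - r F i) (r F) = 0"
      unfolding l2_inner_def by (rule infsum_0) (simp add: r_def)
    then show ?thesis
      using l2_norm_add_sq[of "\<lambda>i. f i - r F i" "r F"] f r by (simp add: s)
  qed
  then have ev: "\<forall>\<^sub>F F in finite_subsets_at_top UNIV.
      sqrt (s - (\<Sum>i\<in>F. (cmod (f i))\<^sup>2)) = l2_norm (\<lambda>i. f i - r F i)"
    by (intro eventually_finite_subsets_at_top_weakI real_sqrt_unique) simp_all
  have "((\<lambda>F. \<Sum>i\<in>F. (cmod (f i))\<^sup>2) \<longlongrightarrow> s) (finite_subsets_at_top UNIV)"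
    using f unfolding s_def l2_def by (intro infsum_tendsto) simp
  from tendsto_real_sqrt[OF tendsto_diff[OF tendsto_const this, of s]]
  have "((\<lambda>F. sqrt (s - (\<Sum>i\<in>F. (cmod (f i))\<^sup>2))) \<longlongrightarrow> 0) (finite_subsets_at_top UNIV)" by simp
  from Lim_transform_eventually[OF this ev] show ?thesis unfolding r_def .
qed

lemma adjoint_exists:
  fixes T :: "('i \<Rightarrow> complex) \<Rightarrow> ('i \<Rightarrow> complex)"
  assumes T: "\<And>f. f \<in> l2 \<Longrightarrow> T f \<in> l2"
    and add: "\<And>f g. f \<in> l2 \<Longrightarrow> g \<in> l2 \<Longrightarrow> T (\<lambda>i. f i + g i) = (\<lambda>i. T f i + T g i)"
    and scale: "\<And>c f. f \<in> l2 \<Longrightarrow> T (\<lambda>i. c * f i) = (\<lambda>i. c * T f i)"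
    and bound: "\<And>f. f \<in> l2 \<Longrightarrow> l2_norm (T f) \<le> l2_norm f"
  obtains T' where "adjoint_pair T T'"
proof -
  define \<delta> :: "'i \<Rightarrow> 'i \<Rightarrow> complex" where "\<delta> i = (\<lambda>j. if j \<in> {i} then 1 else 0)" for i
  have \<delta>: "\<delta> i \<in> l2" for i unfolding \<delta>_def by (rule l2_finite_support) simp
  have fin: "l2_inner (T (\<lambda>i. if i \<in> F then f i else 0)) g = (\<Sum>i\<in>F. f i * l2_inner (T (\<delta> i)) g)"
    if "finite F" "g \<in> l2" for F f g
    using that(1)
  proof (induction F rule: finite_induct)
    case empty
    have "T (\<lambda>i. 0) = (\<lambda>i. 0)" using scale[of "\<lambda>_. 0" 0] by simp
    then show ?case by (simp add: l2_inner_def)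
  next
    case (insert x F)
    have "(\<lambda>i. if i \<in> insert x F then f i else 0) = (\<lambda>i. f x * \<delta> x i + (if i \<in> F then f i else 0))"
      using insert(2) by (auto simp: \<delta>_def)
    moreover have "(\<lambda>i. if i \<in> F then f i else 0) \<in> l2"
      by (rule l2_finite_support) fact
    ultimately show ?case
      using insert that(2) \<delta> by (simp add: add scale T l2_inner_add_left l2_inner_scale_left)
  qed
  define T' where "T' g i = cnj (l2_inner (T (\<delta> i)) g)" for g i
  have T'_l2: "T' g \<in> l2" if g: "g \<in> l2" for g
    unfolding l2_def mem_Collect_eq
  proof (rule nonneg_bdd_above_summable_on)
    show "bdd_above (sum (\<lambda>i. (cmod (T' g i))\<^sup>2) ` {F. F \<subseteq> UNIV \<and> finite F})"
    proof (rule bdd_aboveI2)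
      fix F :: "'i set" assume "F \<in> {F. F \<subseteq> UNIV \<and> finite F}"
      then have F: "finite F" by simp
      define x where "x i = (if i \<in> F then T' g i else 0)" for i
      define s where "s = (\<Sum>i\<in>F. (cmod (T' g i))\<^sup>2)"
      have x: "x \<in> l2" "(l2_norm x)\<^sup>2 = s"
        unfolding x_def[abs_def] s_def by (rule l2_finite_support[OF F])+
      have "l2_inner (T x) g = (\<Sum>i\<in>F. T' g i * cnj (T' g i))"
        unfolding x_def[abs_def] fin[OF F g] by (simp add: T'_def)
      also have "\<dots> = of_real s"
        unfolding s_def of_real_sum complex_norm_square ..
      finally have "cmod (complex_of_real s) \<le> l2_norm (T x) * l2_norm g"
        using l2_Cauchy_Schwarz[OF T[OF x(1)] g] by simp
      also have "\<dots> \<le> l2_norm x * l2_norm g"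
        by (intro mult_right_mono bound x) simp
      finally have "l2_norm x * l2_norm x \<le> l2_norm x * l2_norm g"
        unfolding norm_of_real x(2)[symmetric] power2_eq_square by simp
      then have "l2_norm x \<le> l2_norm g"
        by (metis l2_norm_nonneg less_le mult_le_cancel_left_pos)
      then show "(\<Sum>i\<in>F. (cmod (T' g i))\<^sup>2) \<le> (l2_norm g)\<^sup>2"
        using x(2) unfolding s_def by (metis l2_norm_nonneg power_mono)
    qed
  qed simp
  have "l2_inner (T f) g = l2_inner f (T' g)" if f: "f \<in> l2" and g: "g \<in> l2" for f g
  proof (rule tendsto_unique)
    define r where "r F i = (if i \<in> F then f i else 0)" for F i
    let ?A = "finite_subsets_at_top (UNIV :: 'i set)"
    show "((\<lambda>F. l2_inner (T (r F)) g) \<longlongrightarrow> l2_inner (T f) g) ?A"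
    proof (rule LIM_zero_cancel, rule tendsto_0_le[where K = 1])
      show "((\<lambda>F. l2_norm (\<lambda>i. f i - r F i) * l2_norm g) \<longlongrightarrow> 0) ?A"
        using tendsto_mult_right[OF l2_finite_approx[OF f], of "l2_norm g"] by (simp add: r_def)
      show "\<forall>\<^sub>F F in ?A. cmod (l2_inner (T (r F)) g - l2_inner (T f) g)
          \<le> norm (l2_norm (\<lambda>i. f i - r F i) * l2_norm g) * 1"
      proof (rule eventually_finite_subsets_at_top_weakI)
        fix F :: "'i set" assume "finite F"
        then have r: "r F \<in> l2" unfolding r_def by (rule l2_finite_support)
        have "T (\<lambda>i. (f i - r F i) + r F i) = (\<lambda>i. T (\<lambda>i. f i - r F i) i + T (r F) i)"
          using f r by (intro add) simp_all
        then have "l2_inner (T f) g - l2_inner (T (r F)) g = l2_inner (T (\<lambda>i. f i - r F i)) g"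
          using f r g by (simp add: T l2_inner_add_left)
        moreover have "cmod (l2_inner (T (\<lambda>i. f i - r F i)) g) \<le>
            l2_norm (T (\<lambda>i. f i - r F i)) * l2_norm g"
          using f r g by (intro l2_Cauchy_Schwarz T) simp_all
        moreover have "\<dots> \<le> l2_norm (\<lambda>i. f i - r F i) * l2_norm g"
          using f r by (intro mult_right_mono bound) simp_all
        ultimately show "cmod (l2_inner (T (r F)) g - l2_inner (T f) g)
          \<le> norm (l2_norm (\<lambda>i. f i - r F i) * l2_norm g) * 1"
          by (simp add: norm_minus_commute)
      qed
    qed
    have "((\<lambda>F. \<Sum>i\<in>F. f i * cnj (T' g i)) \<longlongrightarrow> l2_inner f (T' g)) ?A"
      unfolding l2_inner_def by (intro infsum_tendsto l2_inner_summable f T'_l2 g)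
    moreover have "\<forall>\<^sub>F F in ?A. (\<Sum>i\<in>F. f i * cnj (T' g i)) = l2_inner (T (r F)) g"
      by (rule eventually_finite_subsets_at_top_weakI)
        (simp add: r_def[abs_def] fin[OF _ g] T'_def)
    ultimately show "((\<lambda>F. l2_inner (T (r F)) g) \<longlongrightarrow> l2_inner f (T' g)) ?A"
      by (rule Lim_transform_eventually)
  qed simp
  then have "adjoint_pair T T'" unfolding adjoint_pair_def using T T'_l2 by blast
  then show ?thesis by (rule that)
qed

text \<open>\<open>l2_join\<close> identifies the direct sum of two copies of \<open>l2('a \<times> nat)\<close>
  with \<open>l2('a \<times> nat)\<close> itself, through the even and the odd second indices.\<close>

definition l2_join :: "('a \<times> nat \<Rightarrow> complex) \<Rightarrow> ('a \<times> nat \<Rightarrow> complex) \<Rightarrow> 'a \<times> nat \<Rightarrow> complex" where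
  "l2_join f g = (\<lambda>(v, n). if even n then f (v, n div 2) else g (v, n div 2))"

definition l2_even :: "('a \<times> nat \<Rightarrow> complex) \<Rightarrow> 'a \<times> nat \<Rightarrow> complex" where
  "l2_even c = (\<lambda>(v, n). c (v, 2 * n))"

definition l2_odd :: "('a \<times> nat \<Rightarrow> complex) \<Rightarrow> 'a \<times> nat \<Rightarrow> complex" where
  "l2_odd c = (\<lambda>(v, n). c (v, 2 * n + 1))"

lemma l2_join_sel [simp]:
  "l2_even (l2_join f g) = f" "l2_odd (l2_join f g) = g" "l2_join (l2_even c) (l2_odd c) = c"
  by (auto simp: l2_join_def l2_even_def l2_odd_def fun_eq_iff elim!: oddE)

lemma has_sum_even_odd:
  fixes f :: "'a \<times> nat \<Rightarrow> 'b :: topological_comm_monoid_add"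
  assumes "((\<lambda>(v, n). f (v, 2 * n)) has_sum s) UNIV" "((\<lambda>(v, n). f (v, 2 * n + 1)) has_sum t) UNIV"
  shows "(f has_sum (s + t)) UNIV"
proof -
  define e where "e = (\<lambda>(v::'a, n::nat). (v, 2 * n))"
  define d where "d = (\<lambda>(v::'a, n::nat). (v, 2 * n + 1))"
  have "(f has_sum s) (range e)"
    using assms(1) by (subst has_sum_reindex) (auto simp: e_def inj_on_def o_def case_prod_unfold)
  moreover have "(f has_sum t) (range d)"
    using assms(2) by (subst has_sum_reindex) (auto simp: d_def inj_on_def o_def case_prod_unfold)
  moreover have "range e \<inter> range d = {}"
    unfolding e_def d_def by (auto simp: image_iff) (metis even_Suc even_mult_iff dvd_refl dvd_triv_left)
  moreover have "range e \<union> range d = UNIV"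
  proof -
    have "x \<in> range e \<or> x \<in> range d" for x
    proof (cases x)
      case (Pair v n)
      show ?thesis
      proof (cases "even n")
        case True then show ?thesis by (auto simp: Pair e_def image_iff elim!: evenE)
      next
        case False then show ?thesis by (auto simp: Pair d_def image_iff elim!: oddE)
      qed
    qed
    then show ?thesis by blast
  qed
  ultimately show ?thesis by (metis has_sum_Un_disjoint)
qed

lemma l2_join_l2 [simp]:
  assumes "f \<in> l2" "g \<in> l2"
  shows "l2_join f g \<in> l2"
proof -
  from assms obtain s t where "((\<lambda>x. (cmod (f x))\<^sup>2) has_sum s) UNIV" "((\<lambda>x. (cmod (g x))\<^sup>2) has_sum t) UNIV"
    unfolding l2_def summable_on_def by blast
  then have "((\<lambda>x. (cmod (l2_join f g x))\<^sup>2) has_sum (s + t)) UNIV"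
    by (intro has_sum_even_odd) (simp_all add: l2_join_def case_prod_unfold)
  then show ?thesis unfolding l2_def by (auto intro: has_sum_imp_summable)
qed

lemma l2_even_odd_l2 [simp]:
  assumes "c \<in> l2"
  shows "l2_even c \<in> l2" "l2_odd c \<in> l2"
proof -
  let ?f = "\<lambda>x. (cmod (c x))\<^sup>2"
  have s: "?f summable_on A" for A
    using assms summable_on_subset_banach[of ?f UNIV] unfolding l2_def by blast
  show "l2_even c \<in> l2"
    using s[of "range (\<lambda>(v, n). (v, 2 * n))"] unfolding l2_def
    by (subst (asm) summable_on_reindex)
      (auto simp: inj_on_def o_def case_prod_unfold l2_even_def)
  show "l2_odd c \<in> l2"
    using s[of "range (\<lambda>(v, n). (v, 2 * n + 1))"] unfolding l2_def
    by (subst (asm) summable_on_reindex)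
      (auto simp: inj_on_def o_def case_prod_unfold l2_odd_def)
qed

lemma l2_inner_even_odd:
  assumes "c \<in> l2" "d \<in> l2"
  shows "l2_inner c d = l2_inner (l2_even c) (l2_even d) + l2_inner (l2_odd c) (l2_odd d)"
  unfolding l2_inner_def
  using has_sum_infsum[OF l2_inner_summable[OF l2_even_odd_l2(1)[OF assms(1)] l2_even_odd_l2(1)[OF assms(2)]]]
    has_sum_infsum[OF l2_inner_summable[OF l2_even_odd_l2(2)[OF assms(1)] l2_even_odd_l2(2)[OF assms(2)]]]
  by (intro infsumI has_sum_even_odd) (simp_all add: l2_even_def l2_odd_def case_prod_unfold)

lemma l2_norm_join:
  assumes "f \<in> l2" "g \<in> l2"
  shows "(l2_norm (l2_join f g))\<^sup>2 = (l2_norm f)\<^sup>2 + (l2_norm g)\<^sup>2"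
proof -
  have "complex_of_real ((l2_norm (l2_join f g))\<^sup>2) = of_real ((l2_norm f)\<^sup>2 + (l2_norm g)\<^sup>2)"
    using l2_inner_even_odd[of "l2_join f g" "l2_join f g"] assms
    by (simp add: l2_inner_self)
  then show ?thesis by (simp only: of_real_eq_iff)
qed

lemma l2_even_odd_diff:
  "l2_even (\<lambda>i. f i - g i) = (\<lambda>i. l2_even f i - l2_even g i)"
  "l2_odd (\<lambda>i. f i - g i) = (\<lambda>i. l2_odd f i - l2_odd g i)"
  by (auto simp: l2_even_def l2_odd_def)

lemma l2_even_odd_add:
  "l2_even (\<lambda>i. f i + g i) = (\<lambda>i. l2_even f i + l2_even g i)"
  "l2_odd (\<lambda>i. f i + g i) = (\<lambda>i. l2_odd f i + l2_odd g i)"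
  by (auto simp: l2_even_def l2_odd_def)

lemma l2_even_odd_eqI: "l2_even f = l2_even g \<Longrightarrow> l2_odd f = l2_odd g \<Longrightarrow> f = g"
  by (metis l2_join_sel(3))

text \<open>With \<open>W\<close> the Halmos dilation of the isometry \<open>U\<close>, namely the unitary block matrix
  \<open>[[U, I - U U*], [0, U*]]\<close>, the operator below is \<open>W (R \<oplus> R) (C \<oplus> C)\<^sup>-\<^sup>1\<close>.
  Only \<open>S = U R\<close> and \<open>Q = R - U U* R\<close> enter.\<close>

lemma normal_op_dilation:
  fixes U :: "('a \<times> nat \<Rightarrow> complex) \<Rightarrow> 'a \<times> nat \<Rightarrow> complex"
  assumes U: "adjoint_pair U U'" and C: "adjoint_pair C C" and R: "adjoint_pair R R"
    and UC: "\<And>f. f \<in> l2 \<Longrightarrow> U (C f) = C (U f)"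
    and UR: "\<And>f. f \<in> l2 \<Longrightarrow> U (R f) = R (U f)"
    and RC: "\<And>f. f \<in> l2 \<Longrightarrow> R (C f) = C (R f)"
    and iso: "\<And>f. f \<in> l2 \<Longrightarrow> U' (U (R f)) = R f"
    and CR: "\<And>f. f \<in> l2 \<Longrightarrow> (\<lambda>i. C (C f) i + R (R f) i) = f"
    and dense: "l2_dense (C ` l2)"
  obtains D N where "normal_op D N"
    "\<And>x. x \<in> l2 \<Longrightarrow> l2_join (C x) (\<lambda>_. 0) \<in> D \<and> N (l2_join (C x) (\<lambda>_. 0)) = l2_join (U (R x)) (\<lambda>_. 0)"
proof -
  note UD = adjoint_pairD[OF U] and CD = adjoint_pairD[OF C] and RD = adjoint_pairD[OF R]
  have U'C: "U' (C f) = C (U' f)" if "f \<in> l2" for f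
    by (rule adjoint_pair_commute[OF U C UC that])
  have U'R: "U' (R f) = R (U' f)" if "f \<in> l2" for f
    by (rule adjoint_pair_commute[OF U R UR that])
  define S where "S f = U (R f)" for f
  define S' where "S' f = U' (R f)" for f
  define Q where "Q f = (\<lambda>i. R f i - U (S' f) i)" for f
  have S: "adjoint_pair S S'"
  proof -
    have "adjoint_pair S (\<lambda>f. R (U' f))"
      unfolding S_def[abs_def] by (rule adjoint_pair_comp[OF U R])
    then show ?thesis unfolding adjoint_pair_def S'_def by (simp add: U'R)
  qed
  note SD = adjoint_pairD[OF S] and SD' = adjoint_pairD(3)[OF adjoint_pair_sym[OF S]]
  have US': "adjoint_pair (\<lambda>f. U (S' f)) (\<lambda>f. U (S' f))"
  proof -
    have "adjoint_pair (\<lambda>f. U (S' f)) (\<lambda>f. S (U' f))"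
      by (rule adjoint_pair_comp[OF U adjoint_pair_sym[OF S]])
    then show ?thesis unfolding adjoint_pair_def S'_def S_def by (simp add: U'R)
  qed
  have QD: "Q f \<in> l2" if "f \<in> l2" for f
    using that unfolding Q_def by (simp add: RD UD SD)
  have Q: "adjoint_pair Q Q"
    unfolding adjoint_pair_def
  proof (intro conjI ballI)
    fix f g :: "'a \<times> nat \<Rightarrow> complex" assume fg: "f \<in> l2" "g \<in> l2"
    then show "l2_inner (Q f) g = l2_inner f (Q g)"
      using adjoint_pairD(3)[OF US'] adjoint_pairD(1)[OF US'] unfolding Q_def
      by (simp add: l2_inner_diff_left l2_inner_diff_right RD)
  qed (simp_all add: QD)
  have S'S: "S' (S f) = R (R f)" if "f \<in> l2" for f
    using that unfolding S_def S'_def by (simp add: UR[symmetric] RD iso)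
  have QS: "Q (S f) = (\<lambda>_. 0)" if "f \<in> l2" for f
    using that unfolding Q_def S'S[OF that] unfolding S_def by (simp add: UR RD)
  have S'Q: "S' (Q f) = (\<lambda>_. 0)" if f: "f \<in> l2" for f
  proof (rule l2_inner_eqI)
    fix h :: "'a \<times> nat \<Rightarrow> complex" assume h: "h \<in> l2"
    have "l2_inner (S' (Q f)) h = l2_inner f (Q (S h))"
      using f h by (simp add: SD' adjoint_pairD[OF Q] SD)
    then show "l2_inner (S' (Q f)) h = l2_inner (\<lambda>_. 0) h"
      by (simp add: QS[OF h]) (simp add: l2_inner_def)
  qed (use f in \<open>simp_all add: SD QD\<close>)
  have SQ: "(\<lambda>i. S (S' f) i + Q (Q f) i) = R (R f)" if f: "f \<in> l2" for f
  proof -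
    have "Q (U (S' f)) = (\<lambda>_. 0)"
    proof -
      have "U (S' f) = S (U' f)" using f unfolding S'_def S_def by (simp add: U'R)
      then show ?thesis using QS f by (simp add: UD)
    qed
    then have "Q (Q f) = Q (R f)"
      unfolding Q_def[of f] using f by (simp add: adjoint_pair_diff[OF Q] RD UD SD)
    moreover have "U (S' (R f)) = S (S' f)"
      using f unfolding S'_def S_def by (simp add: U'R RD UD)
    ultimately show ?thesis by (simp add: Q_def)
  qed
  have SQ': "(\<lambda>i. Q (Q f) i + S (S' f) i) = R (R f)" if f: "f \<in> l2" for f
    using SQ[OF f] by (simp add: add.commute)
  have CS: "S (C f) = C (S f)" "S' (C f) = C (S' f)" "Q (C f) = C (Q f)" if f: "f \<in> l2" for f
    using f unfolding S_def S'_def Q_def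
    by (simp_all add: UC RC U'C UD RD adjoint_pair_diff[OF C])
  define B where "B c = l2_join (\<lambda>i. S (l2_even c) i + Q (l2_odd c) i) (S' (l2_odd c))" for c
  define B' where "B' c = l2_join (S' (l2_even c)) (\<lambda>i. Q (l2_even c) i + S (l2_odd c) i)" for c
  define D where "D c = l2_join (C (l2_even c)) (C (l2_odd c))" for c
  have B: "adjoint_pair B B'"
    unfolding adjoint_pair_def
  proof (intro conjI ballI)
    fix f g :: "'a \<times> nat \<Rightarrow> complex" assume fg: "f \<in> l2" "g \<in> l2"
    then have "B f \<in> l2" "B' g \<in> l2" unfolding B_def B'_def by (simp_all add: SD QD)
    with fg show "l2_inner (B f) g = l2_inner f (B' g)"
      unfolding l2_inner_even_odd[OF \<open>B f \<in> l2\<close> fg(2)] l2_inner_even_odd[OF fg(1) \<open>B' g \<in> l2\<close>]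
      by (simp add: B_def B'_def l2_inner_add_left l2_inner_add_right
          SD SD' QD adjoint_pairD[OF Q])
  qed (simp_all add: B_def B'_def SD QD)
  have D: "adjoint_pair D D"
    unfolding adjoint_pair_def
  proof (intro conjI ballI)
    fix f g :: "'a \<times> nat \<Rightarrow> complex" assume fg: "f \<in> l2" "g \<in> l2"
    then have "D f \<in> l2" "D g \<in> l2" unfolding D_def by (simp_all add: CD)
    with fg show "l2_inner (D f) g = l2_inner f (D g)"
      unfolding l2_inner_even_odd[OF \<open>D f \<in> l2\<close> fg(2)] l2_inner_even_odd[OF fg(1) \<open>D g \<in> l2\<close>]
      by (simp add: D_def CD)
  qed (simp_all add: D_def CD)
  have BD: "B (D f) = D (B f)" if "f \<in> l2" for f
    using that unfolding B_def D_def by (simp add: CS SD QD adjoint_pair_add[OF C])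
  have BB1: "(\<lambda>i. D (D f) i + B' (B f) i) = f" if f: "f \<in> l2" for f
    using f by - (rule l2_even_odd_eqI,
      simp_all add: l2_even_odd_add B_def B'_def D_def adjoint_pair_add[OF Q]
        adjoint_pair_add[OF adjoint_pair_sym[OF S]] SD QD S'S S'Q QS CR SQ')
  have BB2: "(\<lambda>i. D (D f) i + B (B' f) i) = f" if f: "f \<in> l2" for f
    using f by - (rule l2_even_odd_eqI,
      simp_all add: l2_even_odd_add B_def B'_def D_def adjoint_pair_add[OF Q]
        adjoint_pair_add[OF adjoint_pair_sym[OF S]] SD QD S'S S'Q QS CR SQ)
  have "l2_dense (D ` l2)"
    unfolding l2_dense_def
  proof (intro conjI ballI allI impI)
    show "D ` l2 \<subseteq> l2" by (auto simp: D_def CD)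
    fix f :: "'a \<times> nat \<Rightarrow> complex" and e :: real assume f: "f \<in> l2" and e: "e > 0"
    have "\<exists>x\<in>l2. l2_norm (\<lambda>i. g i - C x i) < e / 2" if "g \<in> l2" for g
      using dense e that unfolding l2_dense_def by (auto dest!: bspec[of _ _ g] spec[of _ "e / 2"])
    then obtain x y where xy: "x \<in> l2" "l2_norm (\<lambda>i. l2_even f i - C x i) < e / 2"
      "y \<in> l2" "l2_norm (\<lambda>i. l2_odd f i - C y i) < e / 2"
      using f l2_even_odd_l2 by metis
    have "(\<lambda>i. f i - D (l2_join x y) i) =
        l2_join (\<lambda>i. l2_even f i - C x i) (\<lambda>i. l2_odd f i - C y i)"
      by (rule l2_even_odd_eqI) (simp_all add: D_def l2_even_odd_diff)
    then have "(l2_norm (\<lambda>i. f i - D (l2_join x y) i))\<^sup>2 =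
        (l2_norm (\<lambda>i. l2_even f i - C x i))\<^sup>2 + (l2_norm (\<lambda>i. l2_odd f i - C y i))\<^sup>2"
      using f xy by (simp add: l2_norm_join CD)
    also have "\<dots> \<le> (e / 2)\<^sup>2 + (e / 2)\<^sup>2"
      using xy by (intro add_mono power_mono) simp_all
    also have "\<dots> < e\<^sup>2" using e by (simp add: power2_eq_square field_simps)
    finally have "l2_norm (\<lambda>i. f i - D (l2_join x y) i) < e"
      using e power_less_imp_less_base less_imp_le by blast
    moreover have "D (l2_join x y) \<in> D ` l2" using xy by simp
    ultimately show "\<exists>g\<in>D ` l2. l2_norm (\<lambda>i. f i - g i) < e" by (rule bexI)
  qed
  from normal_op_quotient[OF B D BD BB1 BB2 this] obtain N
    where N: "normal_op (D ` l2) N" "\<And>x. x \<in> l2 \<Longrightarrow> N (D x) = B x" by blast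
  have zero: "T (\<lambda>_. 0) = (\<lambda>_. 0)" if "adjoint_pair T T'" for T T' :: "('a \<times> nat \<Rightarrow> complex) \<Rightarrow> 'a \<times> nat \<Rightarrow> complex"
    using adjoint_pair_scale[OF that l2_zero, of 0] by simp
  have "l2_join (C x) (\<lambda>_. 0) \<in> D ` l2 \<and> N (l2_join (C x) (\<lambda>_. 0)) = l2_join (U (R x)) (\<lambda>_. 0)"
    if "x \<in> l2" for x
  proof -
    have "l2_join (C x) (\<lambda>_. 0) = D (l2_join x (\<lambda>_. 0))"
      by (simp add: D_def zero[OF C])
    moreover have "B (l2_join x (\<lambda>_. 0)) = l2_join (U (R x)) (\<lambda>_. 0)"
      by (simp add: B_def zero[OF Q] zero[OF adjoint_pair_sym[OF S]]) (simp add: S_def)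
    ultimately show ?thesis using N(2) that by auto
  qed
  with N(1) show ?thesis by (rule that)
qed

section \<open>Orthonormal systems in spaces of square-integrable functions\<close>

function gram_schmidt :: "'a measure \<Rightarrow> (nat \<Rightarrow> 'a \<Rightarrow> real) \<Rightarrow> nat \<Rightarrow> 'a \<Rightarrow> real" where
  "gram_schmidt M a n =
     (let g = (\<lambda>x. a n x - (\<Sum>k<n. (\<integral>y. a n y * gram_schmidt M a k y \<partial>M) * gram_schmidt M a k x));
          s = (\<integral>x. (g x)\<^sup>2 \<partial>M)
      in (\<lambda>x. if s = 0 then 0 else g x / sqrt s))"
  by pat_completeness auto
termination by (relation "Wellfounded.measure (\<lambda>(M, a, n). n)") auto

declare gram_schmidt.simps [simp del]

text \<open>The remainder before normalization; the \<open>n\<close>-th vector is \<open>0\<close> when it vanishes a.e.\<close>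

definition gs_rem :: "'a measure \<Rightarrow> (nat \<Rightarrow> 'a \<Rightarrow> real) \<Rightarrow> nat \<Rightarrow> 'a \<Rightarrow> real" where
  "gs_rem M a n x = a n x - (\<Sum>k<n. (\<integral>y. a n y * gram_schmidt M a k y \<partial>M) * gram_schmidt M a k x)"

lemma gram_schmidt_rem:
  "gram_schmidt M a n x =
     (if (\<integral>y. (gs_rem M a n y)\<^sup>2 \<partial>M) = 0 then 0 else gs_rem M a n x / sqrt (\<integral>y. (gs_rem M a n y)\<^sup>2 \<partial>M))"
  by (subst gram_schmidt.simps) (simp add: Let_def gs_rem_def)

definition sq_integrable :: "'a measure \<Rightarrow> ('a \<Rightarrow> complex) set" where
  "sq_integrable M = {f \<in> borel_measurable M. integrable M (\<lambda>x. (cmod (f x))\<^sup>2)}"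

lemma sq_integrable_scale [simp]:
  "f \<in> sq_integrable M \<Longrightarrow> (\<lambda>x. c * f x) \<in> sq_integrable M"
  by (auto simp: sq_integrable_def norm_mult power_mult_distrib)

lemma sq_integrable_add [simp]:
  assumes "f \<in> sq_integrable M" "g \<in> sq_integrable M"
  shows "(\<lambda>x. f x + g x) \<in> sq_integrable M"
proof -
  have [measurable]: "f \<in> borel_measurable M" "g \<in> borel_measurable M"
    using assms by (auto simp: sq_integrable_def)
  have "integrable M (\<lambda>x. (cmod (f x + g x))\<^sup>2)"
  proof (rule Bochner_Integration.integrable_bound)
    show "integrable M (\<lambda>x. 2 * (cmod (f x))\<^sup>2 + 2 * (cmod (g x))\<^sup>2)"
      using assms by (auto simp: sq_integrable_def)
    show "AE x in M. norm ((cmod (f x + g x))\<^sup>2) \<le> norm (2 * (cmod (f x))\<^sup>2 + 2 * (cmod (g x))\<^sup>2)"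
      using cmod_add_squared_le by simp
  qed measurable
  then show ?thesis by (simp add: sq_integrable_def)
qed

lemma sq_integrable_diff [simp]:
  "f \<in> sq_integrable M \<Longrightarrow> g \<in> sq_integrable M \<Longrightarrow> (\<lambda>x. f x - g x) \<in> sq_integrable M"
  using sq_integrable_add[of f M "\<lambda>x. -1 * g x"] sq_integrable_scale[of g M "-1"] by simp

lemma sq_integrable_nn:
  "f \<in> sq_integrable M \<longleftrightarrow> f \<in> borel_measurable M \<and> (\<integral>\<^sup>+ x. ennreal ((cmod (f x))\<^sup>2) \<partial>M) < \<infinity>"
  by (auto simp: sq_integrable_def integrable_iff_bounded)

locale pi_generated = finite_measure M for M :: "'a measure" +
  fixes A :: "nat \<Rightarrow> 'a set"
  assumes A_Int: "Int_stable (range A)"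
    and A_space: "space M \<in> range A"
    and A_gen: "sets M = sigma_sets (space M) (range A)"
begin

definition e :: "nat \<Rightarrow> 'a \<Rightarrow> real" where
  "e n = gram_schmidt M (\<lambda>k. indicator (A k)) n"

definition coef :: "('a \<Rightarrow> complex) \<Rightarrow> nat \<Rightarrow> complex" where
  "coef f n = (\<integral>x. f x * of_real (e n x) \<partial>M)"

definition g :: "nat \<Rightarrow> 'a \<Rightarrow> real" where
  "g n = gs_rem M (\<lambda>k. indicator (A k)) n"

lemma A_sets [measurable]: "A n \<in> sets M"
  using A_gen by auto

lemma g_eq: "g n x = indicator (A n) x - (\<Sum>k<n. (\<integral>y. indicator (A n) y * e k y \<partial>M) * e k x)"
  unfolding g_def gs_rem_def e_def ..

lemma e_eq: "e n x = (if (\<integral>y. (g n y)\<^sup>2 \<partial>M) = 0 then 0 else g n x / sqrt (\<integral>y. (g n y)\<^sup>2 \<partial>M))"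
  unfolding e_def g_def by (rule gram_schmidt_rem)

lemma e_bounded_measurable: "e n \<in> borel_measurable M \<and> (\<exists>K. \<forall>x. \<bar>e n x\<bar> \<le> K)"
proof (induction n rule: less_induct)
  case (less n)
  then have m: "e k \<in> borel_measurable M" if "k < n" for k using that by auto
  from less obtain K where K: "\<And>k x. k < n \<Longrightarrow> \<bar>e k x\<bar> \<le> K k" by metis
  define c where "c k = (\<integral>y. indicator (A n) y * e k y \<partial>M)" for k
  have gm: "g n \<in> borel_measurable M"
    unfolding g_eq[abs_def] using m by (intro borel_measurable_diff borel_measurable_sum) auto
  have gb: "\<bar>g n x\<bar> \<le> 1 + (\<Sum>k<n. \<bar>c k\<bar> * K k)" for x
  proof -
    have "\<bar>g n x\<bar> \<le> \<bar>indicator (A n) x :: real\<bar> + \<bar>\<Sum>k<n. c k * e k x\<bar>"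
      unfolding g_eq c_def by (rule abs_triangle_ineq4)
    also have "\<bar>\<Sum>k<n. c k * e k x\<bar> \<le> (\<Sum>k<n. \<bar>c k\<bar> * K k)"
      by (rule order_trans[OF sum_abs], rule sum_mono)
        (auto simp: abs_mult intro!: mult_left_mono K)
    finally show ?thesis by (auto split: split_indicator_asm)
  qed
  define s where "s = (\<integral>y. (g n y)\<^sup>2 \<partial>M)"
  have s0: "s \<ge> 0" unfolding s_def by simp
  have "e n \<in> borel_measurable M" using gm unfolding e_eq[abs_def] s_def[symmetric] by simp
  moreover have "\<bar>e n x\<bar> \<le> (1 + (\<Sum>k<n. \<bar>c k\<bar> * K k)) / sqrt s" for x
    using gb[of x] s0 order_trans[OF abs_ge_zero gb[of x]]
    unfolding e_eq s_def[symmetric] by (auto intro!: divide_right_mono)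
  ultimately show ?case by blast
qed

lemma e_measurable [measurable]: "e n \<in> borel_measurable M"
  using e_bounded_measurable by blast

lemma g_measurable [measurable]: "g n \<in> borel_measurable M"
  unfolding g_eq[abs_def] by measurable

lemma e_bounded: obtains K where "K > 0" "\<And>x. \<bar>e n x\<bar> \<le> K"
proof -
  obtain K where "\<forall>x. \<bar>e n x\<bar> \<le> K" using e_bounded_measurable by blast
  then have "\<bar>e n x\<bar> \<le> \<bar>K\<bar> + 1" for x
    using abs_ge_self[of K] by (metis add_increasing2 order_trans zero_le_one)
  then show ?thesis by (intro that[of "\<bar>K\<bar> + 1"]) auto
qed

lemma integrable_mult_e:
  fixes f :: "'a \<Rightarrow> real"
  assumes f: "integrable M f"
  shows "integrable M (\<lambda>x. f x * e n x)"
proof -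
  obtain K where K: "K > 0" "\<And>x. \<bar>e n x\<bar> \<le> K" using e_bounded[of n] by blast
  show ?thesis
  proof (rule Bochner_Integration.integrable_bound)
    show "integrable M (\<lambda>x. K * f x)" using f by simp
    show "AE x in M. norm (f x * e n x) \<le> norm (K * f x)"
      using K by (auto simp: abs_mult mult.commute[of K] intro!: mult_left_mono)
    show "(\<lambda>x. f x * e n x) \<in> borel_measurable M" using f by measurable
  qed
qed

lemma e_integrable: "integrable M (e n)"
  using integrable_mult_e[of "\<lambda>_. 1" n] by simp

lemma indicator_A_integrable: "integrable M (indicator (A n) :: 'a \<Rightarrow> real)"
  by (rule integrable_const_bound[of _ 1]) auto

lemma indicator_e_integrable: "integrable M (\<lambda>x. indicator (A n) x * e k x)"
  by (rule integrable_mult_e[OF indicator_A_integrable])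

lemma g_e_integral:
  assumes ortho: "\<And>j k. j < n \<Longrightarrow> k < n \<Longrightarrow> j \<noteq> k \<Longrightarrow> (\<integral>x. e j x * e k x \<partial>M) = 0"
    and norm: "(\<integral>x. e m x * e m x \<partial>M) = 1 \<or> (\<forall>x. e m x = 0)" and m: "m < n"
  shows "(\<integral>x. g n x * e m x \<partial>M) = 0"
proof -
  define c where "c k = (\<integral>y. indicator (A n) y * e k y \<partial>M)" for k
  have "(\<integral>x. g n x * e m x \<partial>M) = (\<integral>x. indicator (A n) x * e m x - (\<Sum>k<n. c k * (e k x * e m x)) \<partial>M)"
    unfolding g_eq c_def[symmetric] by (simp add: left_diff_distrib sum_distrib_right mult.assoc)
  also have "\<dots> = c m - (\<Sum>k<n. c k * (\<integral>x. e k x * e m x \<partial>M))"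
    by (subst Bochner_Integration.integral_diff)
      (auto simp: c_def indicator_e_integrable integrable_mult_e e_integrable)
  also have "(\<Sum>k<n. c k * (\<integral>x. e k x * e m x \<partial>M)) =
      (\<Sum>k<n. if k = m then c m * (\<integral>x. e m x * e m x \<partial>M) else 0)"
    using ortho m by (intro sum.cong) auto
  also have "\<dots> = c m"
  proof -
    have "c m = 0" if "\<forall>x. e m x = 0" using that by (simp add: c_def)
    then show ?thesis using norm m by auto
  qed
  finally show ?thesis by simp
qed

lemma e_orthonormal:
  "(\<integral>x. e n x * e n x \<partial>M) = 1 \<or> (\<forall>x. e n x = 0)"
  "m < n \<Longrightarrow> (\<integral>x. e m x * e n x \<partial>M) = 0"
proof -
  have "((\<integral>x. e n x * e n x \<partial>M) = 1 \<or> (\<forall>x. e n x = 0)) \<and> (\<forall>m<n. (\<integral>x. e m x * e n x \<partial>M) = 0)"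
  proof (induction n rule: less_induct)
    case (less n)
    define s where "s = (\<integral>y. (g n y)\<^sup>2 \<partial>M)"
    have s0: "s \<ge> 0" unfolding s_def by simp
    have e: "e n x = g n x / sqrt s" if "s \<noteq> 0" for x
      using that unfolding e_eq s_def by simp
    have e0: "e n x = 0" if "s = 0" for x
      using that unfolding e_eq s_def by simp
    have "(\<integral>x. e n x * e n x \<partial>M) = 1" if "s \<noteq> 0"
    proof -
      have "(\<integral>x. e n x * e n x \<partial>M) = (\<integral>x. (g n x)\<^sup>2 / s \<partial>M)"
        using s0 by (simp add: e[OF that] power2_eq_square)
      then show ?thesis using that by (simp add: s_def)
    qed
    moreover have "(\<integral>x. e m x * e n x \<partial>M) = 0" if m: "m < n" for m
    proof (cases "s = 0")
      case False
      have "(\<integral>x. g n x * e m x \<partial>M) = 0"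
      proof (rule g_e_integral[OF _ _ m])
        fix j k assume jk: "j < n" "k < n" "j \<noteq> k"
        show "(\<integral>x. e j x * e k x \<partial>M) = 0"
        proof (cases "j < k")
          case False
          then have "(\<integral>x. e k x * e j x \<partial>M) = 0" using jk less by auto
          then show ?thesis by (simp add: mult.commute)
        qed (use jk less in blast)
      qed (use less m in blast)
      moreover have "e m x * e n x = (g n x * e m x) / sqrt s" for x
        by (simp add: e[OF False])
      ultimately show ?thesis by simp
    qed (simp add: e0)
    ultimately show ?case using e0 by blast
  qed
  then show "(\<integral>x. e n x * e n x \<partial>M) = 1 \<or> (\<forall>x. e n x = 0)"
    "m < n \<Longrightarrow> (\<integral>x. e m x * e n x \<partial>M) = 0" by blast+
qed

lemma e_orthogonal: "m \<noteq> n \<Longrightarrow> (\<integral>x. e m x * e n x \<partial>M) = 0"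
  using e_orthonormal(2)[of m n] e_orthonormal(2)[of n m]
  by (cases "m < n") (simp_all add: mult.commute)

lemma g_eq_e: "AE x in M. g n x = sqrt (\<integral>y. (g n y)\<^sup>2 \<partial>M) * e n x"
proof (cases "(\<integral>y. (g n y)\<^sup>2 \<partial>M) = 0")
  case True
  have "integrable M (\<lambda>x. (g n x)\<^sup>2)"
  proof -
    define c where "c k = (\<integral>y. indicator (A n) y * e k y \<partial>M)" for k
    have gi: "integrable M (g n)"
      unfolding g_eq[abs_def]
      by (intro Bochner_Integration.integrable_diff Bochner_Integration.integrable_sum
          integrable_mult_right e_integrable indicator_A_integrable)
    have "(g n x)\<^sup>2 = g n x * indicator (A n) x - (\<Sum>k<n. c k * (g n x * e k x))" for x
      unfolding power2_eq_square by (subst (2) g_eq)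
        (simp add: c_def right_diff_distrib sum_distrib_left mult_ac)
    then show ?thesis
      using gi by (auto intro!: Bochner_Integration.integrable_diff integrable_mult_e
          integrable_real_mult_indicator)
  qed
  then have "AE x in M. (g n x)\<^sup>2 = 0"
    using True by (subst (asm) integral_nonneg_eq_0_iff_AE) auto
  then show ?thesis using True by simp
next
  case False
  then show ?thesis by (simp add: e_eq)
qed

lemma integrable_sq_integrable:
  assumes "f \<in> sq_integrable M"
  shows "integrable M f"
proof (rule Bochner_Integration.integrable_bound)
  show "integrable M (\<lambda>x. 1 + (cmod (f x))\<^sup>2)" using assms by (simp add: sq_integrable_def)
  have "cmod (f x) \<le> 1 + (cmod (f x))\<^sup>2" for x
  proof -
    have "2 * cmod (f x) \<le> (cmod (f x))\<^sup>2 + 1"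
      using zero_le_power2[of "cmod (f x) - 1"] by (simp add: power2_diff)
    then show ?thesis using norm_ge_zero[of "f x"] by linarith
  qed
  then show "AE x in M. norm (f x) \<le> norm (1 + (cmod (f x))\<^sup>2)" by simp
qed (use assms in \<open>simp add: sq_integrable_def\<close>)

lemma coef_integrable:
  assumes "f \<in> sq_integrable M"
  shows "integrable M (\<lambda>x. f x * of_real (e n x))"
proof -
  obtain K where K: "K > 0" "\<And>x. \<bar>e n x\<bar> \<le> K" using e_bounded[of n] by blast
  show ?thesis
  proof (rule Bochner_Integration.integrable_bound)
    show "integrable M (\<lambda>x. of_real K * f x)" using integrable_sq_integrable[OF assms] by simp
    show "AE x in M. norm (f x * of_real (e n x)) \<le> norm (of_real K * f x)"
      using K by (auto simp: norm_mult mult.commute[of K] intro!: mult_left_mono)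
    show "(\<lambda>x. f x * of_real (e n x)) \<in> borel_measurable M"
      using assms by (auto simp: sq_integrable_def)
  qed
qed

lemma coef_add:
  "f \<in> sq_integrable M \<Longrightarrow> h \<in> sq_integrable M \<Longrightarrow> coef (\<lambda>x. f x + h x) n = coef f n + coef h n"
  unfolding coef_def by (simp add: distrib_right coef_integrable)

lemma coef_scale: "coef (\<lambda>x. c * f x) n = c * coef f n"
  unfolding coef_def by (simp add: mult.assoc)

lemma coef_diff:
  "f \<in> sq_integrable M \<Longrightarrow> h \<in> sq_integrable M \<Longrightarrow> coef (\<lambda>x. f x - h x) n = coef f n - coef h n"
  unfolding coef_def by (simp add: left_diff_distrib coef_integrable)

lemma e_sq_integrable: "(\<lambda>x. complex_of_real (e n x)) \<in> sq_integrable M"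
  using integrable_mult_e[OF e_integrable[of n], of n] by (simp add: sq_integrable_def power2_eq_square)

lemma coef_e: "coef (\<lambda>x. of_real (e m x)) n = (if m = n \<and> \<not> (\<forall>x. e n x = 0) then 1 else 0)"
proof -
  have "coef (\<lambda>x. of_real (e m x)) n = of_real (\<integral>x. e m x * e n x \<partial>M)"
    unfolding coef_def by (simp flip: of_real_mult)
  then show ?thesis
    using e_orthonormal(1)[of n] e_orthogonal[of m n] by auto
qed

definition psum :: "(nat \<Rightarrow> complex) \<Rightarrow> nat \<Rightarrow> 'a \<Rightarrow> complex" where
  "psum c N x = (\<Sum>k<N. c k * of_real (e k x))"

lemma psum_sq_integrable: "psum c N \<in> sq_integrable M"
proof (induction N)
  case 0
  then show ?case by (simp add: psum_def[abs_def] sq_integrable_def)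
next
  case (Suc N)
  have "psum c (Suc N) = (\<lambda>x. psum c N x + c N * of_real (e N x))"
    by (simp add: psum_def fun_eq_iff)
  then show ?case using Suc by (simp add: e_sq_integrable)
qed

lemma psum_measurable [measurable]: "psum c N \<in> borel_measurable M"
  using psum_sq_integrable by (auto simp: sq_integrable_def)

lemma coef_psum:
  assumes "\<And>k. (\<forall>x. e k x = 0) \<Longrightarrow> c k = 0"
  shows "coef (psum c N) n = (if n < N then c n else 0)"
proof (induction N)
  case 0
  then show ?case by (simp add: psum_def[abs_def] coef_def)
next
  case (Suc N)
  have "psum c (Suc N) = (\<lambda>x. psum c N x + c N * of_real (e N x))"
    by (simp add: psum_def fun_eq_iff)
  then have "coef (psum c (Suc N)) n = coef (psum c N) n + c N * coef (\<lambda>x. of_real (e N x)) n"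
    using coef_add[OF psum_sq_integrable[of c N] sq_integrable_scale[OF e_sq_integrable[of N], of "c N"]]
    by (simp only: coef_scale)
  then show ?case using Suc assms by (auto simp: coef_e less_Suc_eq)
qed

lemma coef_null: "(\<forall>x. e k x = 0) \<Longrightarrow> coef f k = 0"
  by (simp add: coef_def)

lemma Bessel_identity:
  assumes f: "f \<in> sq_integrable M"
  shows "(\<integral>x. (cmod (f x - psum (coef f) N x))\<^sup>2 \<partial>M) = (\<integral>x. (cmod (f x))\<^sup>2 \<partial>M) - (\<Sum>k<N. (cmod (coef f k))\<^sup>2)"
proof (induction N)
  case 0
  then show ?case by (simp add: psum_def)
next
  case (Suc N)
  define h where "h x = f x - psum (coef f) N x" for x
  define c where "c = coef f N"
  have h: "h \<in> sq_integrable M" unfolding h_def using f psum_sq_integrable by simp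
  have "coef h N = c"
    unfolding h_def using coef_diff[OF f psum_sq_integrable] coef_psum[of "coef f" N N] coef_null
    by (simp add: c_def)
  have "(cmod (f x - psum (coef f) (Suc N) x))\<^sup>2 =
      (cmod (h x))\<^sup>2 - 2 * Re (cnj c * (h x * of_real (e N x))) + (cmod c)\<^sup>2 * (e N x * e N x)" for x
  proof -
    have "f x - psum (coef f) (Suc N) x = h x - c * of_real (e N x)"
      by (simp add: h_def psum_def c_def)
    show ?thesis
      unfolding \<open>f x - psum (coef f) (Suc N) x = h x - c * of_real (e N x)\<close> cmod_power2
      by (simp add: power2_eq_square algebra_simps)
  qed
  then have "(\<integral>x. (cmod (f x - psum (coef f) (Suc N) x))\<^sup>2 \<partial>M) =
      (\<integral>x. (cmod (h x))\<^sup>2 - 2 * Re (cnj c * (h x * of_real (e N x))) + (cmod c)\<^sup>2 * (e N x * e N x) \<partial>M)"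
    by simp
  also have "\<dots> = (\<integral>x. (cmod (h x))\<^sup>2 \<partial>M) - 2 * Re (cnj c * (\<integral>x. h x * of_real (e N x) \<partial>M))
      + (cmod c)\<^sup>2 * (\<integral>x. e N x * e N x \<partial>M)"
  proof -
    have i1: "integrable M (\<lambda>x. (cmod (h x))\<^sup>2)" using h by (simp add: sq_integrable_def)
    have i2: "integrable M (\<lambda>x. cnj c * (h x * of_real (e N x)))" using coef_integrable[OF h] by simp
    have i3: "integrable M (\<lambda>x. e N x * e N x)" by (rule integrable_mult_e[OF e_integrable])
    have i2': "integrable M (\<lambda>x. 2 * Re (cnj c * (h x * of_real (e N x))))"
      by (intro integrable_mult_right integrable_Re i2)
    have "(\<integral>x. Re (cnj c * (h x * of_real (e N x))) \<partial>M) = Re (\<integral>x. cnj c * (h x * of_real (e N x)) \<partial>M)"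
      by (rule integral_Re[OF i2])
    then have r: "(\<integral>x. 2 * Re (cnj c * (h x * of_real (e N x))) \<partial>M) =
        2 * Re (cnj c * (\<integral>x. h x * of_real (e N x) \<partial>M))"
      by (simp only: integral_mult_right_zero)
    show ?thesis
      unfolding Bochner_Integration.integral_add[OF Bochner_Integration.integrable_diff[OF i1 i2']
          integrable_mult_right[OF i3]] Bochner_Integration.integral_diff[OF i1 i2'] r
      by simp
  qed
  also have "(\<integral>x. h x * of_real (e N x) \<partial>M) = c"
    using \<open>coef h N = c\<close> by (simp add: coef_def)
  also have "Re (cnj c * c) = (cmod c)\<^sup>2"
    unfolding cmod_power2 by (simp add: power2_eq_square)
  also have "(cmod c)\<^sup>2 * (\<integral>x. e N x * e N x \<partial>M) = (cmod c)\<^sup>2"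
    using e_orthonormal(1)[of N] coef_null[of N f] by (auto simp: c_def)
  finally show ?case using Suc by (simp add: h_def c_def)
qed

lemma Bessel_inequality:
  assumes "f \<in> sq_integrable M"
  shows "(\<Sum>k<N. (cmod (coef f k))\<^sup>2) \<le> (\<integral>x. (cmod (f x))\<^sup>2 \<partial>M)"
proof -
  have "0 \<le> (\<integral>x. (cmod (f x - psum (coef f) N x))\<^sup>2 \<partial>M)" by simp
  then show ?thesis unfolding Bessel_identity[OF assms] by simp
qed


lemma coef_zero_imp_AE_zero:
  assumes f: "f \<in> sq_integrable M" and 0: "\<And>n. coef f n = 0"
  shows "AE x in M. f x = 0"
proof -
  have fi: "integrable M f" by (rule integrable_sq_integrable[OF f])
  then have [measurable]: "f \<in> borel_measurable M" by simp
  have basic_A: "(LINT x:A n|M. f x) = 0" for n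
  proof -
    define c where "c k = (\<integral>y. indicator (A n) y * e k y \<partial>M)" for k
    define s where "s = sqrt (\<integral>y. (g n y)\<^sup>2 \<partial>M)"
    have "(\<integral>x. f x * of_real (indicator (A n) x) \<partial>M) =
        (\<integral>x. of_real s * (f x * of_real (e n x)) + (\<Sum>k<n. of_real (c k) * (f x * of_real (e k x))) \<partial>M)"
    proof (rule integral_cong_AE)
      show "AE x in M. f x * complex_of_real (indicator (A n) x) =
          of_real s * (f x * of_real (e n x)) + (\<Sum>k<n. of_real (c k) * (f x * of_real (e k x)))"
        using g_eq_e[of n]
      proof eventually_elim
        case (elim x)
        then have "indicator (A n) x = s * e n x + (\<Sum>k<n. c k * e k x)"
          unfolding g_eq s_def c_def by simp
        then show ?case
          by (simp add: distrib_left sum_distrib_left mult_ac del: of_real_indicator)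
      qed
    qed measurable
    also have "\<dots> = of_real s * coef f n + (\<Sum>k<n. of_real (c k) * coef f k)"
      by (subst Bochner_Integration.integral_add)
        (auto simp: coef_def coef_integrable[OF f])
    finally show ?thesis
      by (simp add: 0 set_lebesgue_integral_def scaleR_conv_of_real mult.commute del: of_real_indicator)
  qed
  have si: "set_integrable M B f" if "B \<in> sets M" for B
    unfolding set_integrable_def using integrable_mult_indicator[OF that fi] .
  have sp: "(LINT x:space M|M. f x) = 0"
    using A_space basic_A by (metis imageE)
  have cl: "range A \<subseteq> Pow (space M)" using A_sets sets.space_closed by blast
  have "(LINT x:B|M. f x) = 0" if "B \<in> sigma_sets (space M) (range A)" for B
    using A_Int cl that
  proof (induction rule: sigma_sets_induct_disjoint)
    case (basic B)
    then show ?case using basic_A by auto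
  next
    case empty
    then show ?case by (simp add: set_lebesgue_integral_def)
  next
    case (compl B)
    then have B: "B \<in> sets M" by (simp add: A_gen)
    have "space M = (space M - B) \<union> B" using sets.sets_into_space[OF B] by auto
    then have "(LINT x:space M|M. f x) = (LINT x:(space M - B) \<union> B|M. f x)" by simp
    also have "\<dots> = (LINT x:space M - B|M. f x) + (LINT x:B|M. f x)"
      by (rule set_integral_Un) (use B si in auto)
    finally show ?case using sp compl by simp
  next
    case (union B)
    then have B: "B i \<in> sets M" for i by (auto simp: A_gen)
    have "(LINT x:(\<Union>i. B i)|M. f x) = (\<Sum>i. (LINT x:(B i)|M. f x))"
      by (rule lebesgue_integral_countable_add)
        (use B si union in \<open>auto simp: disjoint_family_on_def\<close>)
    then show ?case using union by simp
  qed
  then have "AE x in M. f x = (\<lambda>_. 0) x"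
    by (intro density_unique_banach fi) (simp_all add: A_gen set_lebesgue_integral_def)
  then show ?thesis by simp
qed

lemma Riesz_Fischer:
  assumes c: "summable (\<lambda>n. (cmod (c n))\<^sup>2)" and null: "\<And>k. (\<forall>x. e k x = 0) \<Longrightarrow> c k = 0"
  obtains f where "f \<in> sq_integrable M" "\<And>n. coef f n = c n"
    "(\<integral>x. (cmod (f x))\<^sup>2 \<partial>M) = (\<Sum>n. (cmod (c n))\<^sup>2)"
proof -
  define \<sigma> where "\<sigma> N = (\<Sum>k<N. (cmod (c k))\<^sup>2)" for N
  define s where "s = (\<Sum>n. (cmod (c n))\<^sup>2)"
  have \<sigma>s: "\<sigma> \<longlonglongrightarrow> s" unfolding \<sigma>_def s_def using summable_LIMSEQ[OF c] .
  have \<sigma>_mono: "mono \<sigma>" unfolding \<sigma>_def by (intro monoI sum_mono2) auto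
  have \<sigma>_le: "\<sigma> N \<le> s" for N unfolding \<sigma>_def s_def by (rule sum_le_suminf[OF c]) auto
  have "\<exists>N. \<forall>n\<ge>N. s - \<sigma> n \<le> (1/4) ^ k" for k :: nat
  proof -
    obtain N where "\<forall>n\<ge>N. norm (\<sigma> n - s) < (1/4) ^ k"
      using LIMSEQ_D[OF \<sigma>s, of "(1/4) ^ k"] by auto
    then show ?thesis by (intro exI[of _ N]) (auto simp: abs_if split: if_splits)
  qed
  then obtain P where P: "\<And>k n. n \<ge> P k \<Longrightarrow> s - \<sigma> n \<le> (1/4) ^ k" by metis
  define r where "r k = k + (\<Sum>j\<le>k. P j)" for k
  have r_mono: "i \<le> j \<Longrightarrow> r i \<le> r j" for i j
    unfolding r_def by (intro add_mono sum_mono2) auto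
  have r_tail: "s - \<sigma> (r k) \<le> (1/4) ^ k" for k
    by (rule P) (auto simp: r_def intro!: trans_le_add2 member_le_sum)
  have r_ge: "k \<le> r k" for k by (simp add: r_def)
  define S where "S k = psum c (r k)" for k
  have S[measurable]: "S k \<in> borel_measurable M" for k unfolding S_def by simp
  have Ssq: "S k \<in> sq_integrable M" for k unfolding S_def by (rule psum_sq_integrable)
  have dist: "(\<integral>x. (cmod (S j x - S i x))\<^sup>2 \<partial>M) \<le> (1/4) ^ i" if ij: "i \<le> j" for i j
  proof -
    have N: "(\<Sum>k<N. (cmod (coef (S j) k))\<^sup>2) = \<sigma> N" if "N \<le> r j" for N
      unfolding S_def \<sigma>_def using that by (intro sum.cong) (auto simp: coef_psum[OF null])
    have psum_eq: "psum (coef (S j)) N x = psum c N x" if "N \<le> r j" for N x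
      unfolding S_def psum_def[of _ N] using that by (intro sum.cong) (auto simp: coef_psum[OF null])
    have "(\<integral>x. (cmod (S j x - S i x))\<^sup>2 \<partial>M) = (\<integral>x. (cmod (S j x))\<^sup>2 \<partial>M) - \<sigma> (r i)"
      using Bessel_identity[OF Ssq, of j "r i"] r_mono[OF ij] by (simp add: N psum_eq S_def[of i])
    moreover have "0 = (\<integral>x. (cmod (S j x))\<^sup>2 \<partial>M) - \<sigma> (r j)"
      using Bessel_identity[OF Ssq, of j "r j"] by (simp add: N psum_eq) (simp add: S_def)
    ultimately show ?thesis using r_tail[of i] \<sigma>_le[of "r j"] by linarith
  qed
  define d where "d k x = S (Suc k) x - S k x" for k x
  have dsq: "d k \<in> sq_integrable M" for k unfolding d_def[abs_def] using Ssq by simp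
  have [measurable]: "d k \<in> borel_measurable M" for k unfolding d_def[abs_def] by simp
  define m where "m = measure M (space M)"
  have d1: "(\<integral>x. cmod (d k x) \<partial>M) \<le> (m + 1) * (1/2) ^ k" for k
  proof -
    have "cmod (d k x) \<le> (1/2) ^ k + 2 ^ k * (cmod (d k x))\<^sup>2" for x
    proof -
      define t where "t = 2 ^ k * cmod (d k x)"
      have "0 \<le> t" unfolding t_def by simp
      moreover have "2 * t \<le> t\<^sup>2 + 1"
        using zero_le_power2[of "t - 1"] by (simp add: power2_diff)
      ultimately have "t \<le> 1 + t\<^sup>2" by linarith
      then have "(1/2) ^ k * t \<le> (1/2) ^ k * (1 + t\<^sup>2)" by (intro mult_left_mono) simp_all
      then show ?thesis
        unfolding t_def by (simp add: power2_eq_square field_simps power_one_over)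
    qed
    then have "(\<integral>x. cmod (d k x) \<partial>M) \<le> (\<integral>x. (1/2) ^ k + 2 ^ k * (cmod (d k x))\<^sup>2 \<partial>M)"
      using dsq[of k] by (intro integral_mono integrable_norm integrable_sq_integrable)
        (auto simp: sq_integrable_def)
    also have "\<dots> = m * (1/2) ^ k + 2 ^ k * (\<integral>x. (cmod (d k x))\<^sup>2 \<partial>M)"
      using dsq[of k] by (simp add: sq_integrable_def m_def)
    also have "\<dots> \<le> m * (1/2) ^ k + 2 ^ k * (1/4) ^ k"
      using dist[of k "Suc k"] unfolding d_def by simp
    also have "(2::real) ^ k * (1/4) ^ k = (1/2) ^ k"
      by (simp flip: power_mult_distrib)
    finally show ?thesis by (simp add: algebra_simps)
  qed
  have "(\<integral>\<^sup>+x. (\<Sum>k. ennreal (cmod (d k x))) \<partial>M) = (\<Sum>k. \<integral>\<^sup>+x. ennreal (cmod (d k x)) \<partial>M)"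
    by (rule nn_integral_suminf) measurable
  also have "\<dots> \<le> (\<Sum>k. ennreal ((m + 1) * (1/2) ^ k))"
  proof (rule suminf_le)
    fix k
    have "(\<integral>\<^sup>+x. ennreal (cmod (d k x)) \<partial>M) = ennreal (\<integral>x. cmod (d k x) \<partial>M)"
      by (intro nn_integral_eq_integral integrable_norm integrable_sq_integrable dsq) simp
    then show "(\<integral>\<^sup>+x. ennreal (cmod (d k x)) \<partial>M) \<le> ennreal ((m + 1) * (1/2) ^ k)"
      using d1[of k] by (simp add: ennreal_leI)
  qed simp_all
  also have "\<dots> < \<infinity>"
  proof -
    have "summable (\<lambda>k. (m + 1) * (1/2 :: real) ^ k)"
      by (intro summable_mult summable_geometric) simp
    then show ?thesis
      by (subst suminf_ennreal2) (simp_all add: m_def)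
  qed
  finally have "AE x in M. (\<Sum>k. ennreal (cmod (d k x))) \<noteq> \<infinity>"
    by (intro nn_integral_PInf_AE) auto
  then have conv: "AE x in M. convergent (\<lambda>k. S k x)"
  proof eventually_elim
    case (elim x)
    have "summable (\<lambda>k. cmod (d k x))"
      by (rule summable_suminf_not_top) (use elim in auto)
    then have "summable (\<lambda>k. d k x)" by (rule summable_norm_cancel)
    then have "convergent (\<lambda>n. \<Sum>k<n. d k x)" by (simp add: summable_iff_convergent)
    then have "convergent (\<lambda>n. S n x - S 0 x)"
        unfolding d_def by (simp add: sum_lessThan_telescope[of "\<lambda>k. S k x"])
    then have "convergent (\<lambda>n. (S n x - S 0 x) + S 0 x)"
      by (rule convergent_add[OF _ convergent_const])
    then show ?case by simp
  qed
  define f where "f x = lim (\<lambda>k. S k x)" for x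
  have f_meas [measurable]: "f \<in> borel_measurable M"
    unfolding f_def[abs_def] by measurable
  have lim: "AE x in M. (\<lambda>k. S k x) \<longlonglongrightarrow> f x"
    using conv unfolding f_def by eventually_elim (simp add: convergent_LIMSEQ_iff)
  have nn: "(\<integral>\<^sup>+x. ennreal ((cmod (f x - S i x))\<^sup>2) \<partial>M) \<le> ennreal ((1/4) ^ i)" for i
  proof -
    have "(\<integral>\<^sup>+x. ennreal ((cmod (f x - S i x))\<^sup>2) \<partial>M) =
        (\<integral>\<^sup>+x. liminf (\<lambda>j. ennreal ((cmod (S j x - S i x))\<^sup>2)) \<partial>M)"
    proof (rule nn_integral_cong_AE)
      show "AE x in M. ennreal ((cmod (f x - S i x))\<^sup>2) = liminf (\<lambda>j. ennreal ((cmod (S j x - S i x))\<^sup>2))"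
        using lim
      proof eventually_elim
        case (elim x)
        have "(\<lambda>j. ennreal ((cmod (S j x - S i x))\<^sup>2)) \<longlonglongrightarrow> ennreal ((cmod (f x - S i x))\<^sup>2)"
          by (intro tendsto_intros elim)
        from lim_imp_Liminf[OF _ this] show ?case by simp
      qed
    qed
    also have "\<dots> \<le> liminf (\<lambda>j. \<integral>\<^sup>+x. ennreal ((cmod (S j x - S i x))\<^sup>2) \<partial>M)"
      by (rule nn_integral_liminf) measurable
    also have "\<dots> \<le> ennreal ((1/4) ^ i)"
    proof (rule Liminf_le)
      show "\<forall>\<^sub>F j in sequentially. (\<integral>\<^sup>+x. ennreal ((cmod (S j x - S i x))\<^sup>2) \<partial>M) \<le> ennreal ((1/4) ^ i)"
        using eventually_ge_at_top[of i]
      proof eventually_elim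
        case (elim j)
        have "(\<lambda>x. S j x - S i x) \<in> sq_integrable M" using Ssq by simp
        then have "(\<integral>\<^sup>+x. ennreal ((cmod (S j x - S i x))\<^sup>2) \<partial>M) = ennreal (\<integral>x. (cmod (S j x - S i x))\<^sup>2 \<partial>M)"
          by (intro nn_integral_eq_integral) (auto simp: sq_integrable_def)
        then show ?case using dist[OF elim] by (simp add: ennreal_leI)
      qed
    qed simp
    finally show ?thesis .
  qed
  have fS: "(\<lambda>x. f x - S i x) \<in> sq_integrable M" for i
    unfolding sq_integrable_nn using le_less_trans[OF nn[of i]] by simp
  have fS_le: "(\<integral>x. (cmod (f x - S i x))\<^sup>2 \<partial>M) \<le> (1/4) ^ i" for i
  proof -
    have "ennreal (\<integral>x. (cmod (f x - S i x))\<^sup>2 \<partial>M) = (\<integral>\<^sup>+x. ennreal ((cmod (f x - S i x))\<^sup>2) \<partial>M)"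
      using fS[of i] by (intro nn_integral_eq_integral[symmetric]) (auto simp: sq_integrable_def)
    with nn[of i] have "ennreal (\<integral>x. (cmod (f x - S i x))\<^sup>2 \<partial>M) \<le> ennreal ((1/4) ^ i)"
      by (simp only:)
    then show ?thesis by (subst (asm) ennreal_le_iff) simp_all
  qed
  have f: "f \<in> sq_integrable M"
    using sq_integrable_add[OF fS Ssq, of 0 0] by simp
  have coef: "coef f n = c n" for n
  proof -
    have "(cmod (coef f n - c n))\<^sup>2 \<le> (1/4) ^ i" if i: "i > n" for i
    proof -
      have "coef (\<lambda>x. f x - S i x) n = coef f n - c n"
        using coef_diff[OF f Ssq] coef_psum[OF null, where N = "r i" and n = n] r_ge[of i] i by (simp add: S_def)
      then have "(cmod (coef f n - c n))\<^sup>2 \<le> (\<Sum>k<Suc n. (cmod (coef (\<lambda>x. f x - S i x) k))\<^sup>2)"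
        by (simp add: sum_nonneg)
      also have "\<dots> \<le> (1/4) ^ i"
        using Bessel_inequality[OF fS] fS_le by (rule order_trans)
      finally show ?thesis .
    qed
    then have "(cmod (coef f n - c n))\<^sup>2 \<le> 0"
      by (intro LIMSEQ_le_const[OF LIMSEQ_power_zero[of "1/4 :: real"]] exI[of _ "Suc n"]) auto
    then show ?thesis by simp
  qed
  have coef_fun: "coef f = c" using coef by blast
  have "(\<lambda>i. (\<integral>x. (cmod (f x))\<^sup>2 \<partial>M) - \<sigma> (r i)) \<longlonglongrightarrow> 0"
  proof (rule tendsto_sandwich[OF _ _ tendsto_const LIMSEQ_power_zero[of "1/4 :: real"]])
    have eq: "(\<integral>x. (cmod (f x))\<^sup>2 \<partial>M) - \<sigma> (r i) = (\<integral>x. (cmod (f x - S i x))\<^sup>2 \<partial>M)" for i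
      using Bessel_identity[OF f, of "r i"] by (simp add: coef_fun S_def \<sigma>_def)
    show "\<forall>\<^sub>F i in sequentially. 0 \<le> (\<integral>x. (cmod (f x))\<^sup>2 \<partial>M) - \<sigma> (r i)"
      unfolding eq by simp
    show "\<forall>\<^sub>F i in sequentially. (\<integral>x. (cmod (f x))\<^sup>2 \<partial>M) - \<sigma> (r i) \<le> (1/4) ^ i"
      unfolding eq using fS_le by simp
  qed simp
  moreover have "filterlim r at_top sequentially"
    by (rule filterlim_at_top_mono[OF filterlim_ident]) (simp add: r_ge)
  then have "(\<lambda>i. (\<integral>x. (cmod (f x))\<^sup>2 \<partial>M) - \<sigma> (r i)) \<longlonglongrightarrow> (\<integral>x. (cmod (f x))\<^sup>2 \<partial>M) - s"
    by (intro tendsto_diff tendsto_const filterlim_compose[OF \<sigma>s])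
  ultimately have "(\<integral>x. (cmod (f x))\<^sup>2 \<partial>M) - s = 0"
    using LIMSEQ_unique by blast
  then show ?thesis using f coef unfolding s_def by (intro that[of f]) auto
qed

lemma Parseval:
  assumes f: "f \<in> sq_integrable M"
  shows "summable (\<lambda>n. (cmod (coef f n))\<^sup>2)"
    and "(\<integral>x. (cmod (f x))\<^sup>2 \<partial>M) = (\<Sum>n. (cmod (coef f n))\<^sup>2)"
proof -
  show s: "summable (\<lambda>n. (cmod (coef f n))\<^sup>2)"
    by (rule summableI_nonneg_bounded[OF _ Bessel_inequality[OF f]]) simp
  obtain h where h: "h \<in> sq_integrable M" "\<And>n. coef h n = coef f n"
    "(\<integral>x. (cmod (h x))\<^sup>2 \<partial>M) = (\<Sum>n. (cmod (coef f n))\<^sup>2)"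
    using Riesz_Fischer[OF s coef_null] by blast
  have "AE x in M. f x - h x = 0"
    by (rule coef_zero_imp_AE_zero) (use f h in \<open>simp_all add: coef_diff\<close>)
  then have "(\<integral>x. (cmod (f x))\<^sup>2 \<partial>M) = (\<integral>x. (cmod (h x))\<^sup>2 \<partial>M)"
    using f h by (intro integral_cong_AE) (auto simp: sq_integrable_def elim: eventually_mono)
  then show "(\<integral>x. (cmod (f x))\<^sup>2 \<partial>M) = (\<Sum>n. (cmod (coef f n))\<^sup>2)" using h(3) by simp
qed

end

section \<open>Direct sums of spaces of square-integrable functions\<close>

lemma l2_inner_eq_polar_symmetric:
  fixes a b a' b' :: "'i \<Rightarrow> complex"
  assumes l2: "a \<in> l2" "b \<in> l2" "a' \<in> l2" "b' \<in> l2"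
    and eq: "\<And>c. (l2_norm (\<lambda>i. a' i + c * b i))\<^sup>2 + (l2_norm (\<lambda>i. a i + (- c) * b' i))\<^sup>2 =
      (l2_norm (\<lambda>i. a i + c * b' i))\<^sup>2 + (l2_norm (\<lambda>i. a' i + (- c) * b i))\<^sup>2"
  shows "l2_inner a' b = l2_inner a b'"
proof -
  have n: "(l2_norm (\<lambda>i. f i + c * g i))\<^sup>2 =
      (l2_norm f)\<^sup>2 + (cmod c)\<^sup>2 * (l2_norm g)\<^sup>2 + 2 * Re (cnj c * l2_inner f g)"
    if "f \<in> l2" "g \<in> l2" for f g :: "'i \<Rightarrow> complex" and c
    using l2_norm_add_sq[OF that(1) l2_scale[OF that(2)]]
    by (simp add: l2_norm_scale l2_inner_scale_right power_mult_distrib)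
  have "Re (cnj c * l2_inner a' b) = Re (cnj c * l2_inner a b')" for c
    using eq[of c] unfolding n[OF l2(3,2)] n[OF l2(1,4)] by simp
  from this[of 1] this[of \<i>] show ?thesis by (simp add: complex_eq_iff)
qed

locale fibered =
  fixes \<mu> :: "'a \<Rightarrow> 't measure" and A :: "nat \<Rightarrow> 't set"
  assumes fiber: "\<And>v. pi_generated (\<mu> v) A"
begin

definition sq :: "('a \<Rightarrow> 't \<Rightarrow> complex) \<Rightarrow> ennreal" where
  "sq f = (\<integral>\<^sup>+ v. \<integral>\<^sup>+ t. ennreal ((cmod (f v t))\<^sup>2) \<partial>\<mu> v \<partial>count_space UNIV)"

definition K :: "('a \<Rightarrow> 't \<Rightarrow> complex) set" where
  "K = {f. (\<forall>v. f v \<in> borel_measurable (\<mu> v)) \<and> sq f < \<infinity>}"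

definition Psi :: "('a \<Rightarrow> 't \<Rightarrow> complex) \<Rightarrow> 'a \<times> nat \<Rightarrow> complex" where
  "Psi f = (\<lambda>(v, n). pi_generated.coef (\<mu> v) A (f v) n)"

text \<open>Gram-Schmidt yields a zero vector for each indicator that depends linearly on the
  earlier ones. The coordinates at these indices span the orthogonal complement of the range of \<open>Psi\<close>.\<close>

definition null :: "'a \<times> nat \<Rightarrow> bool" where
  "null = (\<lambda>(v, n). \<forall>t. pi_generated.e (\<mu> v) A n t = 0)"

lemma K_fiber:
  assumes "f \<in> K"
  shows "f v \<in> sq_integrable (\<mu> v)"
proof -
  have "(\<integral>\<^sup>+ t. ennreal ((cmod (f v t))\<^sup>2) \<partial>\<mu> v) \<le> sq f"
    unfolding sq_def by (rule nn_integral_ge_point) simp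
  then show ?thesis
    using assms unfolding sq_integrable_nn K_def by (auto intro: le_less_trans)
qed

lemma K_measurable: "f \<in> K \<Longrightarrow> f v \<in> borel_measurable (\<mu> v)"
  by (simp add: K_def)

lemma fiber_norm:
  assumes "f \<in> K"
  shows "(\<integral>\<^sup>+ t. ennreal ((cmod (f v t))\<^sup>2) \<partial>\<mu> v) = (\<Sum>n. ennreal ((cmod (Psi f (v, n)))\<^sup>2))"
proof -
  interpret pi_generated "\<mu> v" A by (rule fiber)
  note f = K_fiber[OF assms, of v]
  have "(\<integral>\<^sup>+ t. ennreal ((cmod (f v t))\<^sup>2) \<partial>\<mu> v) = ennreal (\<integral>t. (cmod (f v t))\<^sup>2 \<partial>\<mu> v)"
    using f by (intro nn_integral_eq_integral) (auto simp: sq_integrable_def)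
  also have "\<dots> = (\<Sum>n. ennreal ((cmod (coef (f v) n))\<^sup>2))"
    unfolding Parseval(2)[OF f] using Parseval(1)[OF f] by (intro suminf_ennreal2[symmetric]) auto
  finally show ?thesis by (simp add: Psi_def)
qed

lemma Psi_sq:
  assumes "f \<in> K"
  shows "(\<integral>\<^sup>+ i. ennreal ((cmod (Psi f i))\<^sup>2) \<partial>count_space UNIV) = sq f"
  unfolding sq_def fiber_norm[OF assms] nn_integral_count_space_nat[symmetric]
  by (rule nn_integral_fst_count_space[symmetric])

lemma Psi_l2 [simp]: "f \<in> K \<Longrightarrow> Psi f \<in> l2"
  unfolding l2_iff_nn by (simp add: Psi_sq) (simp add: K_def)

lemma Psi_norm: "f \<in> K \<Longrightarrow> ennreal ((l2_norm (Psi f))\<^sup>2) = sq f"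
  by (simp add: l2_norm_nn Psi_sq)

lemma Psi_null: "null i \<Longrightarrow> Psi f i = 0"
  using pi_generated.coef_null[OF fiber] unfolding null_def Psi_def by auto

lemma K_scale [simp]:
  assumes "f \<in> K"
  shows "(\<lambda>v t. c * f v t) \<in> K"
proof -
  have "sq (\<lambda>v t. c * f v t) =
      (\<integral>\<^sup>+ v. ennreal ((cmod c)\<^sup>2) * \<integral>\<^sup>+ t. ennreal ((cmod (f v t))\<^sup>2) \<partial>\<mu> v \<partial>count_space UNIV)"
    using K_measurable[OF assms] unfolding sq_def
    by (intro nn_integral_cong)
      (simp add: norm_mult power_mult_distrib ennreal_mult nn_integral_cmult)
  also have "\<dots> = ennreal ((cmod c)\<^sup>2) * sq f" unfolding sq_def by (rule nn_integral_cmult) simp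
  finally show ?thesis using assms by (auto simp: K_def ennreal_mult_less_top intro!: borel_measurable_times)
qed

lemma sq_mono:
  assumes "\<And>v t. t \<in> space (\<mu> v) \<Longrightarrow> cmod (f v t) \<le> cmod (g v t)"
  shows "sq f \<le> sq g"
  unfolding sq_def
  by (intro nn_integral_mono ennreal_leI power_mono assms) auto

lemma sq_add:
  assumes "f \<in> K" "g \<in> K" "f' \<in> K" "g' \<in> K"
    and "\<And>v t. (cmod (f v t))\<^sup>2 + (cmod (g v t))\<^sup>2 = (cmod (f' v t))\<^sup>2 + (cmod (g' v t))\<^sup>2"
  shows "sq f + sq g = sq f' + sq g'"
proof -
  have *: "sq f + sq g = (\<integral>\<^sup>+ v. \<integral>\<^sup>+ t. ennreal ((cmod (f v t))\<^sup>2 + (cmod (g v t))\<^sup>2) \<partial>\<mu> v \<partial>count_space UNIV)"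
    if "f \<in> K" "g \<in> K" for f g
    using K_measurable[OF that(1)] K_measurable[OF that(2)] unfolding sq_def
    by (simp add: nn_integral_add)
  show ?thesis using assms by (simp add: *)
qed

lemma K_add [simp]:
  assumes "f \<in> K" "g \<in> K"
  shows "(\<lambda>v t. f v t + g v t) \<in> K"
proof -
  have m: "f v \<in> borel_measurable (\<mu> v)" "g v \<in> borel_measurable (\<mu> v)" for v
    using assms by (auto simp: K_def)
  have "sq (\<lambda>v t. f v t + g v t) \<le> (\<integral>\<^sup>+ v. \<integral>\<^sup>+ t. ennreal (2 * (cmod (f v t))\<^sup>2 + 2 * (cmod (g v t))\<^sup>2) \<partial>\<mu> v \<partial>count_space UNIV)"
    unfolding sq_def by (intro nn_integral_mono ennreal_leI cmod_add_squared_le)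
  also have "\<dots> = 2 * sq f + 2 * sq g"
    unfolding sq_def using m
    by (simp add: nn_integral_add nn_integral_cmult ennreal_mult)
  also have "\<dots> < \<infinity>" using assms by (auto simp: K_def ennreal_mult_less_top)
  finally show ?thesis using m by (simp add: K_def)
qed

lemma K_diff [simp]: "f \<in> K \<Longrightarrow> g \<in> K \<Longrightarrow> (\<lambda>v t. f v t - g v t) \<in> K"
  using K_add[of f "\<lambda>v t. -1 * g v t"] K_scale[of g "-1"] by simp

lemma Psi_add:
  assumes "f \<in> K" "g \<in> K"
  shows "Psi (\<lambda>v t. f v t + g v t) = (\<lambda>i. Psi f i + Psi g i)"
  using pi_generated.coef_add[OF fiber K_fiber[OF assms(1)] K_fiber[OF assms(2)]]
  by (auto simp: Psi_def)

lemma Psi_diff: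
  assumes "f \<in> K" "g \<in> K"
  shows "Psi (\<lambda>v t. f v t - g v t) = (\<lambda>i. Psi f i - Psi g i)"
  using pi_generated.coef_diff[OF fiber K_fiber[OF assms(1)] K_fiber[OF assms(2)]]
  by (auto simp: Psi_def)

lemma Psi_scale: "Psi (\<lambda>v t. c * f v t) = (\<lambda>i. c * Psi f i)"
  using pi_generated.coef_scale[OF fiber] by (auto simp: Psi_def)

lemma Psi_onto:
  assumes c: "c \<in> l2"
  obtains f where "f \<in> K" "\<And>i. Psi f i = (if null i then 0 else c i)"
proof -
  define d where "d i = (if null i then 0 else c i)" for i
  have nn: "(\<integral>\<^sup>+ v. (\<Sum>n. ennreal ((cmod (d (v, n)))\<^sup>2)) \<partial>count_space UNIV) < \<infinity>"
  proof -
    have "(\<integral>\<^sup>+ i. ennreal ((cmod (d i))\<^sup>2) \<partial>count_space UNIV) \<le>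
        (\<integral>\<^sup>+ i. ennreal ((cmod (c i))\<^sup>2) \<partial>count_space UNIV)"
      by (intro nn_integral_mono ennreal_leI) (auto simp: d_def)
    also have "\<dots> < \<infinity>" using c by (simp add: l2_iff_nn)
    finally show ?thesis
      unfolding nn_integral_count_space_nat[symmetric]
      using nn_integral_fst_count_space[of "\<lambda>i. ennreal ((cmod (d i))\<^sup>2)"] by simp
  qed
  have "\<exists>h. h \<in> sq_integrable (\<mu> v) \<and> (\<forall>n. pi_generated.coef (\<mu> v) A h n = d (v, n)) \<and>
      (\<integral>\<^sup>+ t. ennreal ((cmod (h t))\<^sup>2) \<partial>\<mu> v) = (\<Sum>n. ennreal ((cmod (d (v, n)))\<^sup>2))" for v
  proof -
    interpret pi_generated "\<mu> v" A by (rule fiber)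
    have "(\<Sum>n. ennreal ((cmod (d (v, n)))\<^sup>2)) \<noteq> top"
    proof -
      have "(\<Sum>n. ennreal ((cmod (d (v, n)))\<^sup>2)) \<le> (\<integral>\<^sup>+ v. (\<Sum>n. ennreal ((cmod (d (v, n)))\<^sup>2)) \<partial>count_space UNIV)"
        by (rule nn_integral_ge_point) simp
      then show ?thesis using nn by (metis infinity_ennreal_def leD)
    qed
    then have s: "summable (\<lambda>n. (cmod (d (v, n)))\<^sup>2)"
      by (intro summable_suminf_not_top) auto
    have null: "d (v, k) = 0" if "\<forall>t. e k t = 0" for k
      using that by (simp add: d_def null_def)
    obtain h where h: "h \<in> sq_integrable (\<mu> v)" "\<And>n. coef h n = d (v, n)"
      "(\<integral>t. (cmod (h t))\<^sup>2 \<partial>\<mu> v) = (\<Sum>n. (cmod (d (v, n)))\<^sup>2)"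
      using Riesz_Fischer[OF s null] by blast
    have "(\<integral>\<^sup>+ t. ennreal ((cmod (h t))\<^sup>2) \<partial>\<mu> v) = ennreal (\<integral>t. (cmod (h t))\<^sup>2 \<partial>\<mu> v)"
      using h(1) by (intro nn_integral_eq_integral) (auto simp: sq_integrable_def)
    also have "\<dots> = (\<Sum>n. ennreal ((cmod (d (v, n)))\<^sup>2))"
      unfolding h(3) by (intro suminf_ennreal2[symmetric] s) simp
    finally show ?thesis using h by blast
  qed
  then obtain f where f: "\<And>v. f v \<in> sq_integrable (\<mu> v)"
    "\<And>v n. pi_generated.coef (\<mu> v) A (f v) n = d (v, n)"
    "\<And>v. (\<integral>\<^sup>+ t. ennreal ((cmod (f v t))\<^sup>2) \<partial>\<mu> v) = (\<Sum>n. ennreal ((cmod (d (v, n)))\<^sup>2))"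
    by metis
  have "f \<in> K" using nn f(1) by (auto simp: K_def sq_def f(3) sq_integrable_def)
  moreover have "Psi f i = d i" for i by (cases i) (simp add: Psi_def f)
  ultimately show ?thesis using that by (simp add: d_def)
qed

definition Theta :: "('a \<times> nat \<Rightarrow> complex) \<Rightarrow> 'a \<Rightarrow> 't \<Rightarrow> complex" where
  "Theta c = (SOME f. f \<in> K \<and> (\<forall>i. Psi f i = (if null i then 0 else c i)))"

lemma Theta:
  assumes "c \<in> l2"
  shows "Theta c \<in> K" "Psi (Theta c) i = (if null i then 0 else c i)"
proof -
  have "\<exists>f. f \<in> K \<and> (\<forall>i. Psi f i = (if null i then 0 else c i))"
    using Psi_onto[OF assms] by metis
  from someI_ex[OF this] show "Theta c \<in> K" "Psi (Theta c) i = (if null i then 0 else c i)"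
    unfolding Theta_def by blast+
qed

lemma Psi_Theta_Psi: "f \<in> K \<Longrightarrow> Psi (Theta (Psi f)) = Psi f"
  by (rule ext) (simp add: Theta(2) Psi_null)

lemma inner_Psi_Theta:
  assumes "f \<in> K" "c \<in> l2"
  shows "l2_inner (Psi f) c = l2_inner (Psi f) (Psi (Theta c))"
  unfolding l2_inner_def by (intro infsum_cong) (auto simp: Theta[OF assms(2)] Psi_null)

definition K_op :: "(('a \<Rightarrow> 't \<Rightarrow> complex) \<Rightarrow> 'a \<Rightarrow> 't \<Rightarrow> complex) \<Rightarrow> bool" where
  "K_op T \<longleftrightarrow> (\<forall>f\<in>K. T f \<in> K \<and> sq (T f) \<le> sq f) \<and>
     (\<forall>f\<in>K. \<forall>g\<in>K. T (\<lambda>v t. f v t + g v t) = (\<lambda>v t. T f v t + T g v t)) \<and>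
     (\<forall>c. \<forall>f\<in>K. T (\<lambda>v t. c * f v t) = (\<lambda>v t. c * T f v t))"

lemma K_opD:
  assumes "K_op T"
  shows "f \<in> K \<Longrightarrow> T f \<in> K" "f \<in> K \<Longrightarrow> sq (T f) \<le> sq f"
    "f \<in> K \<Longrightarrow> g \<in> K \<Longrightarrow> T (\<lambda>v t. f v t + g v t) = (\<lambda>v t. T f v t + T g v t)"
    "f \<in> K \<Longrightarrow> T (\<lambda>v t. c * f v t) = (\<lambda>v t. c * T f v t)"
  using assms unfolding K_op_def by auto

definition lift :: "(('a \<Rightarrow> 't \<Rightarrow> complex) \<Rightarrow> 'a \<Rightarrow> 't \<Rightarrow> complex) \<Rightarrow>
    ('a \<times> nat \<Rightarrow> complex) \<Rightarrow> 'a \<times> nat \<Rightarrow> complex" where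
  "lift T c = Psi (T (Theta c))"

lemma lift_l2 [simp]: "K_op T \<Longrightarrow> c \<in> l2 \<Longrightarrow> lift T c \<in> l2"
  by (simp add: lift_def K_opD Theta)

lemma Psi_cong:
  assumes T: "K_op T" and fg: "f \<in> K" "g \<in> K" "Psi f = Psi g"
  shows "Psi (T f) = Psi (T g)"
proof -
  define h where "h v t = f v t + -1 * g v t" for v t
  have g': "(\<lambda>v t. -1 * g v t) \<in> K" by (rule K_scale) fact
  have h: "h \<in> K" unfolding h_def[abs_def] by (rule K_add[OF fg(1) g'])
  have "Psi h = (\<lambda>_. 0)"
    unfolding h_def[abs_def] Psi_add[OF fg(1) g'] Psi_scale fg(3) by simp
  then have "sq h = 0" using Psi_sq[OF h] by simp
  then have "sq (T h) = 0" using K_opD(2)[OF T h] by simp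
  then have "l2_norm (Psi (T h)) = 0"
    using Psi_norm[OF K_opD(1)[OF T h]] by (simp add: ennreal_eq_0_iff)
  then have "Psi (T h) = (\<lambda>_. 0)"
    by (intro l2_norm_eq_0 Psi_l2 K_opD(1)[OF T h])
  moreover have "T h = (\<lambda>v t. T f v t + -1 * T g v t)"
    unfolding h_def[abs_def] K_opD(3)[OF T fg(1) g'] K_opD(4)[OF T fg(2)] ..
  ultimately have "(\<lambda>i. Psi (T f) i + -1 * Psi (T g) i) = (\<lambda>_. 0)"
    using Psi_add[OF K_opD(1)[OF T fg(1)] K_scale[OF K_opD(1)[OF T fg(2)]], of "-1"]
    by (simp only: Psi_scale)
  then show ?thesis by (auto simp: fun_eq_iff)
qed

lemma lift_Psi: "K_op T \<Longrightarrow> f \<in> K \<Longrightarrow> lift T (Psi f) = Psi (T f)"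
  unfolding lift_def by (rule Psi_cong) (simp_all add: Theta Psi_Theta_Psi)

lemma lift_lift:
  "K_op T \<Longrightarrow> K_op S \<Longrightarrow> c \<in> l2 \<Longrightarrow> lift T (lift S c) = lift (\<lambda>f. T (S f)) c"
  unfolding lift_def[of S] by (subst lift_Psi) (simp_all add: K_opD Theta lift_def)

lemma lift_add:
  assumes T: "K_op T" and cd: "c \<in> l2" "d \<in> l2"
  shows "lift T (\<lambda>i. c i + d i) = (\<lambda>i. lift T c i + lift T d i)"
proof -
  have "lift T (\<lambda>i. c i + d i) = Psi (T (\<lambda>v t. Theta c v t + Theta d v t))"
    unfolding lift_def by (rule Psi_cong[OF T])
      (use cd in \<open>auto simp: Theta Psi_add fun_eq_iff\<close>)
  also have "\<dots> = (\<lambda>i. lift T c i + lift T d i)"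
    using cd by (simp add: K_opD[OF T] Theta Psi_add lift_def)
  finally show ?thesis .
qed

lemma lift_scale:
  assumes T: "K_op T" and c: "c \<in> l2"
  shows "lift T (\<lambda>i. a * c i) = (\<lambda>i. a * lift T c i)"
proof -
  have "lift T (\<lambda>i. a * c i) = Psi (T (\<lambda>v t. a * Theta c v t))"
    unfolding lift_def by (rule Psi_cong[OF T])
      (use c in \<open>auto simp: Theta Psi_scale fun_eq_iff\<close>)
  also have "\<dots> = (\<lambda>i. a * lift T c i)"
    using c by (simp add: K_opD[OF T] Theta Psi_scale lift_def)
  finally show ?thesis .
qed

lemma Psi_norm_mono:
  assumes "f \<in> K" "g \<in> K" "sq f \<le> sq g"
  shows "l2_norm (Psi f) \<le> l2_norm (Psi g)"
proof (rule power2_le_imp_le)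
  have "ennreal ((l2_norm (Psi f))\<^sup>2) \<le> ennreal ((l2_norm (Psi g))\<^sup>2)"
    using assms by (simp add: Psi_norm)
  then show "(l2_norm (Psi f))\<^sup>2 \<le> (l2_norm (Psi g))\<^sup>2" by (subst (asm) ennreal_le_iff) simp_all
qed simp

lemma Theta_norm:
  assumes "c \<in> l2"
  shows "l2_norm (Psi (Theta c)) \<le> l2_norm c"
  unfolding l2_norm_def
proof (intro real_sqrt_le_mono infsum_mono)
  show "(\<lambda>i. (cmod (Psi (Theta c) i))\<^sup>2) summable_on UNIV" "(\<lambda>i. (cmod (c i))\<^sup>2) summable_on UNIV"
    using assms Psi_l2[OF Theta(1)[OF assms]] by (auto simp: l2_def)
qed (simp add: Theta[OF assms])

lemma lift_norm:
  assumes "K_op T" "c \<in> l2"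
  shows "l2_norm (lift T c) \<le> l2_norm c"
  unfolding lift_def
  by (rule order_trans[OF Psi_norm_mono Theta_norm]) (use assms in \<open>simp_all add: K_opD Theta\<close>)

lemma lift_adjoint_exists:
  assumes "K_op T"
  obtains T' where "adjoint_pair (lift T) T'"
  by (rule adjoint_exists[of "lift T"]) (use assms in \<open>auto simp: lift_add lift_scale lift_norm\<close>)

lemma Psi_inner_isometry:
  assumes T: "K_op T" and iso: "\<And>f. f \<in> K \<Longrightarrow> sq (T f) = sq f" and fg: "f \<in> K" "g \<in> K"
  shows "l2_inner (Psi (T f)) (Psi (T g)) = l2_inner (Psi f) (Psi g)"
proof -
  have n: "l2_norm (Psi (T h)) = l2_norm (Psi h)" if "h \<in> K" for h
    using that by (intro antisym Psi_norm_mono) (simp_all add: iso K_opD[OF T])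
  have "l2_norm (\<lambda>i. Psi (T f) i + c * Psi (T g) i) = l2_norm (\<lambda>i. Psi f i + c * Psi g i)" for c
    using n[of "\<lambda>v t. f v t + c * g v t"] fg by (simp add: K_opD[OF T] Psi_add Psi_scale)
  then show ?thesis
    using fg n by (intro l2_inner_polar) (simp_all add: K_opD[OF T])
qed

definition mult :: "('t \<Rightarrow> real) \<Rightarrow> ('a \<Rightarrow> 't \<Rightarrow> complex) \<Rightarrow> 'a \<Rightarrow> 't \<Rightarrow> complex" where
  "mult m f v t = of_real (m t) * f v t"

definition symbol :: "real \<Rightarrow> ('t \<Rightarrow> real) \<Rightarrow> bool" where
  "symbol B m \<longleftrightarrow> (\<forall>v. m \<in> borel_measurable (\<mu> v) \<and> (\<forall>t\<in>space (\<mu> v). \<bar>m t\<bar> \<le> B))"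

lemma mult_K:
  assumes m: "symbol B m" and f: "f \<in> K"
  shows "mult m f \<in> K"
proof -
  have "sq (mult m f) \<le> sq (\<lambda>v t. of_real B * f v t)"
  proof (rule sq_mono)
    fix v t assume "t \<in> space (\<mu> v)"
    then have "\<bar>m t\<bar> \<le> \<bar>B\<bar>" using m unfolding symbol_def by fastforce
    then show "cmod (mult m f v t) \<le> cmod (of_real B * f v t)"
      by (simp add: mult_def norm_mult mult_right_mono)
  qed
  also have "\<dots> < \<infinity>" using K_scale[OF f] by (simp add: K_def)
  moreover have "mult m f v \<in> borel_measurable (\<mu> v)" for v
  proof -
    have [measurable]: "m \<in> borel_measurable (\<mu> v)" "f v \<in> borel_measurable (\<mu> v)"
      using m K_measurable[OF f] unfolding symbol_def by blast+
    show ?thesis unfolding mult_def[abs_def] by measurable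
  qed
  ultimately show ?thesis by (simp add: K_def)
qed

lemma mult_K_op:
  assumes m: "symbol 1 m"
  shows "K_op (mult m)"
  unfolding K_op_def
proof (intro conjI ballI allI)
  fix f assume f: "f \<in> K"
  show "mult m f \<in> K" by (rule mult_K[OF m f])
  show "sq (mult m f) \<le> sq f"
    by (rule sq_mono) (simp add: mult_def norm_mult mult_left_le_one_le m[unfolded symbol_def])
qed (auto simp: mult_def[abs_def] algebra_simps)

lemma mult_adjoint:
  assumes m: "symbol 1 m"
  shows "adjoint_pair (lift (mult m)) (lift (mult m))"
proof -
  note T = mult_K_op[OF m]
  note TD = K_opD[OF T]
  have "l2_inner (Psi (mult m f)) (Psi g) = l2_inner (Psi f) (Psi (mult m g))"
    if fg: "f \<in> K" "g \<in> K" for f g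
  proof (rule l2_inner_eq_polar_symmetric)
    fix c
    have p: "(\<lambda>i. Psi a i + c * Psi b i) = Psi (\<lambda>v t. a v t + c * b v t)" if "a \<in> K" "b \<in> K" for a b c
      using that by (simp add: Psi_add Psi_scale)
    have k: "(\<lambda>v t. a v t + c * b v t) \<in> K" if "a \<in> K" "b \<in> K" for a b c
      using that by simp
    note mf = TD(1)[OF fg(1)] and mg = TD(1)[OF fg(2)]
    have "sq (\<lambda>v t. mult m f v t + c * g v t) + sq (\<lambda>v t. f v t + - c * mult m g v t) =
        sq (\<lambda>v t. f v t + c * mult m g v t) + sq (\<lambda>v t. mult m f v t + - c * g v t)"
      by (rule sq_add)
        (intro k fg mf mg, intro k fg mf mg, intro k fg mf mg, intro k fg mf mg,
          simp only: mult_def cmod_power2, simp add: power2_eq_square algebra_simps)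
    then have "ennreal ((l2_norm (\<lambda>i. Psi (mult m f) i + c * Psi g i))\<^sup>2 + (l2_norm (\<lambda>i. Psi f i + - c * Psi (mult m g) i))\<^sup>2) =
        ennreal ((l2_norm (\<lambda>i. Psi f i + c * Psi (mult m g) i))\<^sup>2 + (l2_norm (\<lambda>i. Psi (mult m f) i + - c * Psi g i))\<^sup>2)"
      unfolding p[OF mf fg(2)] p[OF fg(1) mg]
      by (subst (1 2) ennreal_plus) (simp_all only: Psi_norm[OF k[OF mf fg(2)]] Psi_norm[OF k[OF fg(1) mg]] zero_le_power2)
    then show "(l2_norm (\<lambda>i. Psi (mult m f) i + c * Psi g i))\<^sup>2 + (l2_norm (\<lambda>i. Psi f i + - c * Psi (mult m g) i))\<^sup>2 =
        (l2_norm (\<lambda>i. Psi f i + c * Psi (mult m g) i))\<^sup>2 + (l2_norm (\<lambda>i. Psi (mult m f) i + - c * Psi g i))\<^sup>2"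
      by (subst (asm) ennreal_inj) simp_all
  qed (use fg in \<open>simp_all add: TD\<close>)
  then have "l2_inner (lift (mult m) c) d = l2_inner c (lift (mult m) d)" if cd: "c \<in> l2" "d \<in> l2" for c d
  proof -
    assume sym: "\<And>f g. f \<in> K \<Longrightarrow> g \<in> K \<Longrightarrow> l2_inner (Psi (mult m f)) (Psi g) = l2_inner (Psi f) (Psi (mult m g))"
    have "l2_inner (lift (mult m) c) d = l2_inner (Psi (Theta c)) (Psi (mult m (Theta d)))"
      unfolding lift_def using cd by (simp add: inner_Psi_Theta[of _ d] TD Theta sym)
    also have "\<dots> = l2_inner c (lift (mult m) d)"
      using inner_Psi_Theta[OF TD(1)[OF Theta(1)[OF cd(2)]] cd(1)] unfolding lift_def
      by (metis l2_inner_cnj)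
    finally show ?thesis .
  qed
  then show ?thesis unfolding adjoint_pair_def using T by simp
qed

lemma cutoff_tendsto:
  assumes k: "\<And>v. k \<in> borel_measurable (\<mu> v)" "\<And>v t. t \<in> space (\<mu> v) \<Longrightarrow> k t > 0" and f: "f \<in> K"
  shows "(\<lambda>n. sq (mult (\<lambda>t. if k t < 1 / real (Suc n) then 1 else 0) f)) \<longlonglongrightarrow> 0"
proof -
  note k(1)[measurable] K_measurable[OF f, measurable]
  have fin: "(\<integral>\<^sup>+ t. ennreal ((cmod (f v t))\<^sup>2) \<partial>\<mu> v) < \<infinity>" for v
    using K_fiber[OF f] unfolding sq_integrable_nn by blast
  let ?c = "\<lambda>n t. if k t < 1 / real (Suc n) then 1 else (0::real)"
  have le: "ennreal ((cmod (mult (?c n) f v t))\<^sup>2) \<le> ennreal ((cmod (f v t))\<^sup>2)" for n v t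
    by (simp add: mult_def)
  have inner: "(\<lambda>n. \<integral>\<^sup>+ t. ennreal ((cmod (mult (?c n) f v t))\<^sup>2) \<partial>\<mu> v) \<longlonglongrightarrow> (\<integral>\<^sup>+ t. 0 \<partial>\<mu> v)" for v
  proof (rule nn_integral_dominated_convergence[OF _ _ _ _ fin])
    show "AE t in \<mu> v. (\<lambda>n. ennreal ((cmod (mult (?c n) f v t))\<^sup>2)) \<longlonglongrightarrow> 0"
    proof (rule AE_I2, rule tendsto_eventually)
      fix t assume "t \<in> space (\<mu> v)"
      then obtain N where N: "1 / real (Suc N) < k t"
        using k(2) reals_Archimedean[of "k t"] by (auto simp: inverse_eq_divide)
      show "\<forall>\<^sub>F n in sequentially. ennreal ((cmod (mult (?c n) f v t))\<^sup>2) = 0"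
        using eventually_ge_at_top[of N]
      proof eventually_elim
        case (elim n)
        then have "1 / real (Suc n) \<le> 1 / real (Suc N)" by (simp add: frac_le)
        then show ?case using N by (simp add: mult_def)
      qed
    qed
  qed (use le in \<open>auto simp: mult_def[abs_def]\<close>)
  have "(\<lambda>n. sq (mult (?c n) f)) \<longlonglongrightarrow> (\<integral>\<^sup>+ v. (0 :: ennreal) \<partial>count_space (UNIV :: 'a set))"
    unfolding sq_def
  proof (rule nn_integral_dominated_convergence)
    show "(\<integral>\<^sup>+ v. \<integral>\<^sup>+ t. ennreal ((cmod (f v t))\<^sup>2) \<partial>\<mu> v \<partial>count_space UNIV) < \<infinity>"
      using f by (simp add: K_def sq_def)
    show "AE v in count_space UNIV. (\<lambda>n. \<integral>\<^sup>+ t. ennreal ((cmod (mult (?c n) f v t))\<^sup>2) \<partial>\<mu> v) \<longlonglongrightarrow> 0"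
      using inner by simp
  qed (use le in \<open>auto intro!: nn_integral_mono\<close>)
  then show ?thesis by simp
qed

end

context fibered
begin

lemma Psi_cong_AE:
  assumes "f \<in> K" "g \<in> K" "\<And>v. AE t in \<mu> v. f v t = g v t"
  shows "Psi f = Psi g"
proof
  fix i :: "'a \<times> nat"
  obtain v n where i: "i = (v, n)" by fastforce
  interpret pi_generated "\<mu> v" A by (rule fiber)
  have [measurable]: "f v \<in> borel_measurable (\<mu> v)" "g v \<in> borel_measurable (\<mu> v)"
    using assms K_measurable by auto
  have "coef (f v) n = coef (g v) n"
    unfolding coef_def using assms(3)[of v]
    by (intro integral_cong_AE) (measurable, auto elim: eventually_mono)
  then show "Psi f i = Psi g i" by (simp add: i Psi_def)
qed

lemma Psi_cong_space:
  assumes "f \<in> K" "g \<in> K" "\<And>v t. t \<in> space (\<mu> v) \<Longrightarrow> f v t = g v t"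
  shows "Psi f = Psi g"
  using assms by (intro Psi_cong_AE AE_I2)

lemma mult_comm: "mult m (mult r f) = mult r (mult m f)"
  by (simp add: mult_def[abs_def] fun_eq_iff)

text \<open>Here \<open>C = I + Psi (k - 1) Theta\<close>, so that \<open>C\<close> is the identity on the orthogonal complement
  of the range of \<open>Psi\<close>, while \<open>R\<close> vanishes there.\<close>

lemma normal_extension:
  assumes U: "K_op U" and isometry: "\<forall>f\<in>K. sq (U f) = sq f"
    and comm: "\<And>m f. U (mult m f) = mult m (U f)"
    and k: "symbol 1 k" and r: "symbol 1 r"
    and pos: "\<forall>v. \<forall>t\<in>space (\<mu> v). 0 < k t"
    and squares: "\<forall>v. \<forall>t\<in>space (\<mu> v). (k t)\<^sup>2 + (r t)\<^sup>2 = 1"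
  obtains D N where "normal_op D N"
    "\<And>f. f \<in> K \<Longrightarrow> l2_join (Psi (mult k f)) (\<lambda>_. 0) \<in> D \<and>
       N (l2_join (Psi (mult k f)) (\<lambda>_. 0)) = l2_join (Psi (U (mult r f))) (\<lambda>_. 0)"
proof -
  have iso: "sq (U f) = sq f" if "f \<in> K" for f using isometry that by blast
  have k_pos: "0 < k t" and kr: "(k t)\<^sup>2 + (r t)\<^sup>2 = 1" if "t \<in> space (\<mu> v)" for v t
    using pos squares that by blast+
  define m where "m t = k t - 1" for t
  have m: "symbol 1 m"
  proof -
    have "\<bar>m t\<bar> \<le> 1" if "t \<in> space (\<mu> v)" for v t
      using k_pos[OF that] k that unfolding symbol_def m_def by fastforce
    then show ?thesis using k unfolding symbol_def m_def[abs_def] by (auto intro!: borel_measurable_diff)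
  qed
  define M where "M = lift (mult m)"
  define R where "R = lift (mult r)"
  define C where "C c = (\<lambda>i. c i + M c i)" for c
  define V where "V = lift U"
  note Mop = mult_K_op[OF m] and Rop = mult_K_op[OF r]
  have Ma: "adjoint_pair M M" unfolding M_def by (rule mult_adjoint[OF m])
  have Ra: "adjoint_pair R R" unfolding R_def by (rule mult_adjoint[OF r])
  obtain V' where Va: "adjoint_pair V V'" unfolding V_def using lift_adjoint_exists[OF U] .
  note MD = adjoint_pairD[OF Ma] and RD = adjoint_pairD[OF Ra] and VD = adjoint_pairD[OF Va]
  have CD: "C c \<in> l2" if "c \<in> l2" for c using that unfolding C_def by (simp add: MD)
  have Ca: "adjoint_pair C C"
    unfolding adjoint_pair_def
    by (auto simp: C_def MD l2_inner_add_left l2_inner_add_right)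
  have VM: "V (M c) = M (V c)" and VR: "V (R c) = R (V c)" and RM: "R (M c) = M (R c)"
    if "c \<in> l2" for c
    using that unfolding V_def M_def R_def
    by (simp_all add: lift_lift U Mop Rop comm mult_comm[of r m])
  have VC: "V (C c) = C (V c)" and RC: "R (C c) = C (R c)" if "c \<in> l2" for c
    using that unfolding C_def
    by (simp_all add: adjoint_pair_add[OF Va] adjoint_pair_add[OF Ra] MD VM RM)
  have iso': "V' (V (R c)) = R c" if c: "c \<in> l2" for c
  proof (rule l2_inner_eqI)
    fix d :: "'a \<times> nat \<Rightarrow> complex" assume d: "d \<in> l2"
    have VRc: "V (R c) = Psi (U (mult r (Theta c)))"
      unfolding V_def R_def lift_lift[OF U Rop c] by (simp add: lift_def)
    have "l2_inner (V' (V (R c))) d = l2_inner (V (R c)) (V d)"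
      using c d by (simp add: adjoint_pairD[OF adjoint_pair_sym[OF Va]] RD VD)
    also have "\<dots> = l2_inner (Psi (mult r (Theta c))) (Psi (Theta d))"
      unfolding VRc unfolding V_def lift_def using c d
      by (intro Psi_inner_isometry[OF U iso] K_opD(1)[OF Rop] Theta(1)) simp_all
    also have "\<dots> = l2_inner (R c) d"
      unfolding R_def lift_def using c d
      by (intro inner_Psi_Theta[symmetric] K_opD(1)[OF Rop] Theta(1)) simp_all
    finally show "l2_inner (V' (V (R c))) d = l2_inner (R c) d" .
  qed (use c in \<open>simp_all add: RD VD\<close>)
  have CR: "(\<lambda>i. C (C c) i + R (R c) i) = c" if c: "c \<in> l2" for c
  proof -
    define \<theta> where "\<theta> = Theta c"
    have \<theta>: "\<theta> \<in> K" unfolding \<theta>_def by (rule Theta(1)[OF c])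
    have Mc: "M c = Psi (mult m \<theta>)" by (simp add: M_def lift_def \<theta>_def)
    have MMc: "M (M c) = Psi (mult m (mult m \<theta>))" and RRc: "R (R c) = Psi (mult r (mult r \<theta>))"
      unfolding M_def R_def lift_lift[OF Mop Mop c] lift_lift[OF Rop Rop c] unfolding lift_def \<theta>_def by auto
    have mK: "mult m f \<in> K" "mult r f \<in> K" if "f \<in> K" for f
      using K_opD(1)[OF Mop that] K_opD(1)[OF Rop that] by auto
    define h where "h = (\<lambda>v t. (mult m \<theta> v t + mult m \<theta> v t) + (mult m (mult m \<theta>) v t + mult r (mult r \<theta>) v t))"
    have "Psi h = Psi (\<lambda>v t. 0 * \<theta> v t)"
    proof (rule Psi_cong_space)
      show "h \<in> K" unfolding h_def by (intro K_add mK \<theta>)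
      show "(\<lambda>v t. 0 * \<theta> v t) \<in> K" by (rule K_scale[OF \<theta>])
      fix v t assume t: "t \<in> space (\<mu> v)"
      have "2 * m t + (m t)\<^sup>2 + (r t)\<^sup>2 = 0"
        using kr[OF t] by (simp add: m_def power2_eq_square algebra_simps)
      then have "complex_of_real (2 * m t + (m t)\<^sup>2 + (r t)\<^sup>2) * \<theta> v t = 0" by simp
      then show "h v t = 0 * \<theta> v t"
        by (simp add: h_def mult_def power2_eq_square algebra_simps)
    qed
    then have "(\<lambda>i. (M c i + M c i) + (M (M c) i + R (R c) i)) = (\<lambda>_. 0)"
      unfolding h_def Mc MMc[unfolded Mc] RRc Psi_scale
      using \<theta> mK by (simp add: Psi_add Psi_scale)
    then have "(M c i + M c i) + (M (M c) i + R (R c) i) = 0" for i by meson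
    moreover have "C (C c) i = c i + M c i + (M c i + M (M c) i)" for i
      unfolding C_def using c by (simp add: adjoint_pair_add[OF Ma] MD)
    ultimately show ?thesis by (auto simp: fun_eq_iff algebra_simps)
  qed
  have C_Psi: "C (Psi f) = Psi (mult k f)" if f: "f \<in> K" for f
  proof -
    have "C (Psi f) = Psi (\<lambda>v t. f v t + mult m f v t)"
      unfolding C_def M_def using f by (simp add: lift_Psi[OF Mop] Psi_add K_opD[OF Mop])
    also have "(\<lambda>v t. f v t + mult m f v t) = mult k f"
      by (auto simp: mult_def m_def fun_eq_iff algebra_simps)
    finally show ?thesis .
  qed
  have dense: "l2_dense (C ` l2)"
    unfolding l2_dense_def
  proof (intro conjI ballI allI impI)
    show "C ` l2 \<subseteq> l2" using CD by auto
    fix c :: "'a \<times> nat \<Rightarrow> complex" and \<epsilon> :: real assume c: "c \<in> l2" and \<epsilon>: "\<epsilon> > 0"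
    define \<theta> where "\<theta> = Theta c"
    have \<theta>: "\<theta> \<in> K" unfolding \<theta>_def by (rule Theta(1)[OF c])
    let ?c = "\<lambda>n t. if k t < 1 / real (Suc n) then 1 else (0::real)"
    have km: "k \<in> borel_measurable (\<mu> v)" for v using k by (simp add: symbol_def)
    have "(\<lambda>n. sq (mult (?c n) \<theta>)) \<longlonglongrightarrow> 0"
      by (rule cutoff_tendsto[OF km k_pos \<theta>])
    then have "\<forall>\<^sub>F n in sequentially. sq (mult (?c n) \<theta>) < ennreal (\<epsilon>\<^sup>2)"
      using \<epsilon> by (intro order_tendstoD(2)) auto
    from eventually_happens'[OF sequentially_bot this]
    obtain n where n: "sq (mult (?c n) \<theta>) < ennreal (\<epsilon>\<^sup>2)" ..
    have cK: "mult (?c n) \<theta> \<in> K"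
    proof (rule mult_K[OF _ \<theta>])
      show "symbol 1 (?c n)" unfolding symbol_def using km by (auto intro!: measurable_If)
    qed
    define w where "w t = (if k t < 1 / real (Suc n) then 0 else 1 / k t)" for t
    define f where "f = mult w \<theta>"
    have f: "f \<in> K"
      unfolding f_def
    proof (rule mult_K[OF _ \<theta>])
      have "\<bar>w t\<bar> \<le> real (Suc n)" if "t \<in> space (\<mu> v)" for v t
      proof (cases "k t < 1 / real (Suc n)")
        case False
        then have "1 \<le> k t * real (Suc n)" by (simp add: field_simps)
        then show ?thesis using k_pos[OF that] False by (simp add: w_def field_simps)
      qed (simp add: w_def)
      moreover have "w \<in> borel_measurable (\<mu> v)" for v
        unfolding w_def[abs_def] using km[of v] by measurable
      ultimately show "symbol (real (Suc n)) w" unfolding symbol_def by blast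
    qed
    define x where "x = (\<lambda>i. (c i - Psi \<theta> i) + Psi f i)"
    have x: "x \<in> l2" unfolding x_def using c f \<theta> by simp
    have "M (\<lambda>i. c i - Psi \<theta> i) = (\<lambda>_. 0)"
    proof -
      have "M (Psi \<theta>) = M c"
        unfolding M_def lift_Psi[OF Mop \<theta>] by (simp add: lift_def \<theta>_def)
      then show ?thesis using c \<theta> by (simp add: adjoint_pair_diff[OF Ma])
    qed
    then have "C x = (\<lambda>i. (c i - Psi \<theta> i) + Psi (mult k f) i)"
      using c f \<theta> C_Psi[OF f]
      unfolding x_def C_def by (simp add: adjoint_pair_add[OF Ma] fun_eq_iff add.assoc)
    then have "(\<lambda>i. c i - C x i) = (\<lambda>i. Psi \<theta> i - Psi (mult k f) i)"
      by (auto simp: fun_eq_iff)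
    also have "\<dots> = Psi (\<lambda>v t. \<theta> v t - mult k f v t)"
      by (rule Psi_diff[symmetric]) (use \<theta> f mult_K[OF k] in auto)
    also have "\<dots> = Psi (mult (?c n) \<theta>)"
    proof (rule Psi_cong_space)
      fix v t assume t: "t \<in> space (\<mu> v)"
      show "\<theta> v t - mult k f v t = mult (?c n) \<theta> v t"
        using k_pos[OF t] by (simp add: f_def w_def mult_def)
    qed (use \<theta> f mult_K[OF k] cK in auto)
    finally have eq: "(\<lambda>i. c i - C x i) = Psi (mult (?c n) \<theta>)" .
    have "ennreal ((l2_norm (\<lambda>i. c i - C x i))\<^sup>2) < ennreal (\<epsilon>\<^sup>2)"
      unfolding eq Psi_norm[OF cK] by (rule n)
    then have "(l2_norm (\<lambda>i. c i - C x i))\<^sup>2 < \<epsilon>\<^sup>2"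
      by (subst (asm) ennreal_less_iff) simp_all
    then have "l2_norm (\<lambda>i. c i - C x i) < \<epsilon>"
      using \<epsilon> power_less_imp_less_base less_imp_le by blast
    then show "\<exists>g\<in>C ` l2. l2_norm (\<lambda>i. c i - g i) < \<epsilon>"
      using x by (intro bexI[of _ "C x"]) simp_all
  qed
  obtain D N where N: "normal_op D N"
    "\<And>x. x \<in> l2 \<Longrightarrow> l2_join (C x) (\<lambda>_. 0) \<in> D \<and> N (l2_join (C x) (\<lambda>_. 0)) = l2_join (V (R x)) (\<lambda>_. 0)"
    using normal_op_dilation[OF Va Ca Ra VC VR RC iso' CR dense] by metis
  have "V (R (Psi f)) = Psi (U (mult r f))" if "f \<in> K" for f
    using that unfolding V_def R_def by (simp add: lift_Psi Rop U K_opD[OF Rop])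
  then show ?thesis using that[OF N(1)] N(2) C_Psi Psi_l2 by metis
qed

end

lemma countable_generator_nonneg_reals:
  obtains A :: "nat \<Rightarrow> real set" where "Int_stable (range A)" "{0..} \<in> range A"
    "sets (restrict_space borel {0..}) = sigma_sets {0..} (range A)"
proof -
  define G where "G = insert UNIV (range (\<lambda>q::rat. {..real_of_rat q}))"
  have G: "sigma_sets UNIV G = sets borel"
  proof
    show "sigma_sets UNIV G \<subseteq> sets borel"
      by (rule sets.sigma_sets_subset[of G borel, simplified]) (auto simp: G_def)
    have "sets (borel :: real measure) = sigma_sets UNIV (range atMost)"
      unfolding borel_eq_atMost by simp
    also have "\<dots> \<subseteq> sigma_sets UNIV G"
    proof (rule sigma_sets_mono)
      show "range atMost \<subseteq> sigma_sets UNIV G"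
      proof
        fix X :: "real set" assume "X \<in> range atMost"
        then obtain a where X: "X = {..a}" by blast
        have "X = UNIV - \<Union> ((\<lambda>q. UNIV - {..real_of_rat q}) ` {q. a < real_of_rat q})"
          unfolding X using of_rat_dense by (auto simp: not_le) (meson leD not_le_imp_less)
        also have "\<dots> \<in> sigma_sets UNIV G"
        proof (intro sigma_sets.Compl sigma_sets_UNION)
          fix B assume "B \<in> (\<lambda>q. UNIV - {..real_of_rat q}) ` {q. a < real_of_rat q}"
          then obtain q where "B = UNIV - {..real_of_rat q}" by blast
          then show "B \<in> sigma_sets UNIV G"
            using sigma_sets.Compl[OF sigma_sets.Basic, of "{..real_of_rat q}" G UNIV] by (simp add: G_def)
        qed simp
        finally show "X \<in> sigma_sets UNIV G" .
      qed
    qed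
    finally show "sets borel \<subseteq> sigma_sets UNIV G" .
  qed
  define H where "H = (\<inter>) {0..} ` G"
  have "countable H" "H \<noteq> {}" by (auto simp: H_def G_def)
  then have rng: "range (from_nat_into H) = H" by (simp add: range_from_nat_into)
  have "Int_stable H"
  proof (rule Int_stableI)
    fix a b assume "a \<in> H" "b \<in> H"
    then obtain a' b' where ab: "a' \<in> G" "b' \<in> G" "a = {0..} \<inter> a'" "b = {0..} \<inter> b'"
      unfolding H_def by blast
    have "a' \<inter> b' \<in> G"
    proof -
      have "{..real_of_rat p} \<inter> {..real_of_rat q} = {..real_of_rat (min p q)}" for p q
        by (auto simp: min_def of_rat_less_eq)
      then show ?thesis using ab unfolding G_def by auto
    qed
    moreover have "a \<inter> b = {0..} \<inter> (a' \<inter> b')" using ab by blast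
    ultimately show "a \<inter> b \<in> H" unfolding H_def by blast
  qed
  moreover have "{0..} \<in> H" unfolding H_def G_def by blast
  moreover have "sets (restrict_space borel {0..}) = sigma_sets {0..} H"
    unfolding sets_restrict_space H_def G[symmetric]
    by (rule sigma_sets_Int) (auto simp: G)
  ultimately show ?thesis using that[of "from_nat_into H"] rng by simp
qed

section \<open>The shift inside the direct sum\<close>

text \<open>The junk value \<open>1 / sqrt 0 = 0\<close> is harmless: the measures have no atom at \<open>0\<close>.\<close>

definition isometric_part ::
  "('a \<times> 'a) set \<Rightarrow> ('a \<Rightarrow> complex) \<Rightarrow> ('a \<Rightarrow> real \<Rightarrow> complex) \<Rightarrow> 'a \<Rightarrow> real \<Rightarrow> complex" where
  "isometric_part E lam f v t = lam v * of_real (1 / sqrt t) * f (par E v) t"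

locale consistent_tree =
  fixes E :: "('a \<times> 'a) set"
    and lam :: "'a \<Rightarrow> complex"
    and \<mu> :: "'a \<Rightarrow> real measure"
    and A :: "nat \<Rightarrow> real set"
  assumes tree: "directed_tree E" and rootless: "rootless E"
    and lam_nz: "\<And>v. lam v \<noteq> 0"
    and prob: "\<And>v. prob_space (\<mu> v)"
    and sets_\<mu>: "\<And>v. sets (\<mu> v) = sets (restrict_space borel {0::real..})"
    and consistent: "\<And>u \<sigma>. \<sigma> \<in> sets (restrict_space borel {0::real..}) \<Longrightarrow>
           emeasure (\<mu> u) \<sigma> =
             (\<integral>\<^sup>+ v. ennreal ((cmod (lam v))\<^sup>2) *
                  (\<integral>\<^sup>+ t. indicator \<sigma> t * inverse (ennreal t) \<partial>(\<mu> v)) \<partial>count_space (Chi E u))"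
    and A_Int: "Int_stable (range A)" and A_space: "{0..} \<in> range A"
    and A_gen: "sets (restrict_space borel {0..}) = sigma_sets {0..} (range A)"
begin

lemma space_\<mu>: "space (\<mu> v) = {0..}"
  using sets_eq_imp_space_eq[OF sets_\<mu>[of v]] by (simp add: space_restrict_space)

sublocale fibered \<mu> A
proof (intro fibered.intro pi_generated.intro pi_generated_axioms.intro)
  fix v
  show "finite_measure (\<mu> v)" by (rule prob_space.axioms(1)[OF prob])
qed (simp_all add: space_\<mu> sets_\<mu> A_Int A_space A_gen)

lemma borel_measurable_\<mu>:
  "h \<in> borel_measurable borel \<Longrightarrow> h \<in> borel_measurable (\<mu> v)"
  by (subst measurable_cong_sets[OF sets_\<mu> refl]) (rule measurable_restrict_space1)

lemma measurable_\<mu>_cong: "borel_measurable (\<mu> v) = borel_measurable (\<mu> u)"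
  by (rule measurable_cong_sets) (simp_all add: sets_\<mu>)

lemma ident_measurable [measurable]: "(\<lambda>t. t) \<in> borel_measurable (\<mu> v)"
  by (rule borel_measurable_\<mu>) simp

lemma edge_iff: "(u, v) \<in> E \<longleftrightarrow> u = par E v"
proof -
  obtain w where w: "(w, v) \<in> E" using rootless unfolding rootless_def by blast
  have uniq: "x = w" if "(x, v) \<in> E" for x
    using tree w that unfolding directed_tree_def by blast
  then have "par E v = w" unfolding par_def using w by blast
  then show ?thesis using w uniq by blast
qed

lemma AE_pos: "AE t in \<mu> v. t > 0"
proof -
  define u where "u = par E v"
  have v: "v \<in> Chi E u" unfolding Chi_def by (simp add: edge_iff u_def)
  have z: "{0::real} \<in> sets (restrict_space borel {0..})"
    by (simp add: sets_restrict_space_iff)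
  have "ennreal ((cmod (lam v))\<^sup>2) * (\<integral>\<^sup>+ t. indicator {0} t * inverse (ennreal t) \<partial>(\<mu> v)) \<le> emeasure (\<mu> u) {0}"
    unfolding consistent[OF z] by (rule nn_integral_ge_point[OF v])
  also have "\<dots> < \<infinity>"
  proof -
    interpret prob_space "\<mu> u" by (rule prob)
    show ?thesis unfolding infinity_ennreal_def less_top[symmetric] by (rule emeasure_finite)
  qed
  finally have "(\<integral>\<^sup>+ t. indicator {0} t * inverse (ennreal t) \<partial>(\<mu> v)) < \<infinity>"
    using lam_nz[of v] by (auto simp: ennreal_mult_less_top ennreal_eq_0_iff)
  moreover have "(\<integral>\<^sup>+ t. indicator {0} t * inverse (ennreal t) \<partial>(\<mu> v)) = (\<integral>\<^sup>+ t. \<infinity> * indicator {0} t \<partial>(\<mu> v))"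
    by (intro nn_integral_cong) (auto split: split_indicator)
  moreover have "\<dots> = \<infinity> * emeasure (\<mu> v) {0}"
    by (rule nn_integral_cmult_indicator) (simp add: sets_\<mu> z)
  ultimately have "emeasure (\<mu> v) {0} = 0"
    by (auto simp: ennreal_top_mult split: if_splits)
  then have "{0} \<in> null_sets (\<mu> v)" using z by (simp add: null_sets_def sets_\<mu>)
  then have "AE t in \<mu> v. t \<notin> {0}" by (rule AE_not_in)
  then show ?thesis using AE_space by eventually_elim (auto simp: space_\<mu>)
qed

lemma consistent_nn_integral:
  fixes h :: "real \<Rightarrow> ennreal"
  assumes "h \<in> borel_measurable (\<mu> u)"
  shows "(\<integral>\<^sup>+ t. h t \<partial>\<mu> u) =
    (\<integral>\<^sup>+ v. ennreal ((cmod (lam v))\<^sup>2) * (\<integral>\<^sup>+ t. h t * inverse (ennreal t) \<partial>(\<mu> v)) \<partial>count_space (Chi E u))"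
  using assms
proof (induction rule: borel_measurable_induct)
  case (cong f g)
  have "(\<integral>\<^sup>+ t. f t \<partial>\<mu> u) = (\<integral>\<^sup>+ t. g t \<partial>\<mu> u)"
    by (intro nn_integral_cong cong)
  moreover have "(\<integral>\<^sup>+ t. f t * inverse (ennreal t) \<partial>(\<mu> v)) = (\<integral>\<^sup>+ t. g t * inverse (ennreal t) \<partial>(\<mu> v))" for v
    by (intro nn_integral_cong) (use cong in \<open>simp add: space_\<mu>\<close>)
  ultimately show ?case using cong by simp
next
  case (set \<sigma>)
  then show ?case by (simp add: consistent sets_\<mu>)
next
  case (mult f c)
  then have [measurable]: "f \<in> borel_measurable (\<mu> v)" for v using measurable_\<mu>_cong by blast
  show ?case
    by (simp add: nn_integral_cmult mult.assoc mult mult.left_commute[of _ c])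
next
  case (add f g)
  then have [measurable]: "f \<in> borel_measurable (\<mu> v)" "g \<in> borel_measurable (\<mu> v)" for v
    using measurable_\<mu>_cong by blast+
  show ?case
    by (simp add: nn_integral_add distrib_left distrib_right add)
next
  case (seq F)
  then have [measurable]: "F i \<in> borel_measurable (\<mu> v)" for i v
    using measurable_\<mu>_cong by blast
  have inc: "incseq F" by fact
  have incF: "F i t \<le> F j t" if "i \<le> j" for i j t
    using inc that by (auto simp: incseq_def le_fun_def)
  have "(\<integral>\<^sup>+ t. (SUP i. F i) t \<partial>\<mu> u) = (SUP i. \<integral>\<^sup>+ t. F i t \<partial>\<mu> u)"
    by (simp add: nn_integral_monotone_convergence_SUP[OF inc] image_comp)
  also have "\<dots> = (SUP i. \<integral>\<^sup>+ v. ennreal ((cmod (lam v))\<^sup>2) * (\<integral>\<^sup>+ t. F i t * inverse (ennreal t) \<partial>(\<mu> v)) \<partial>count_space (Chi E u))"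
    by (simp add: seq)
  also have "\<dots> = (\<integral>\<^sup>+ v. (SUP i. ennreal ((cmod (lam v))\<^sup>2) * (\<integral>\<^sup>+ t. F i t * inverse (ennreal t) \<partial>(\<mu> v))) \<partial>count_space (Chi E u))"
    by (rule nn_integral_monotone_convergence_SUP[symmetric])
      (auto simp: incseq_def le_fun_def intro!: mult_left_mono nn_integral_mono mult_right_mono incF)
  also have "\<dots> = (\<integral>\<^sup>+ v. ennreal ((cmod (lam v))\<^sup>2) * (\<integral>\<^sup>+ t. (SUP i. F i) t * inverse (ennreal t) \<partial>(\<mu> v)) \<partial>count_space (Chi E u))"
  proof (intro nn_integral_cong)
    fix v
    have "(\<integral>\<^sup>+ t. (SUP i. F i) t * inverse (ennreal t) \<partial>(\<mu> v)) = (\<integral>\<^sup>+ t. (SUP i. F i t * inverse (ennreal t)) \<partial>(\<mu> v))"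
      by (simp add: image_comp SUP_mult_right_ennreal)
    also have "\<dots> = (SUP i. \<integral>\<^sup>+ t. F i t * inverse (ennreal t) \<partial>(\<mu> v))"
      by (rule nn_integral_monotone_convergence_SUP)
        (auto simp: incseq_def le_fun_def intro!: mult_right_mono incF)
    finally show "(SUP i. ennreal ((cmod (lam v))\<^sup>2) * (\<integral>\<^sup>+ t. F i t * inverse (ennreal t) \<partial>(\<mu> v))) =
        ennreal ((cmod (lam v))\<^sup>2) * (\<integral>\<^sup>+ t. (SUP i. F i) t * inverse (ennreal t) \<partial>(\<mu> v))"
      by (simp add: SUP_mult_left_ennreal)
  qed
  finally show ?case .
qed

abbreviation U where "U \<equiv> isometric_part E lam"

lemma U_measurable:
  assumes "\<And>v. f v \<in> borel_measurable (\<mu> v)"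
  shows "U f v \<in> borel_measurable (\<mu> v)"
proof -
  have [measurable]: "f (par E v) \<in> borel_measurable (\<mu> v)"
    using assms measurable_\<mu>_cong by blast
  show ?thesis unfolding isometric_part_def[abs_def] by measurable
qed

lemma sq_U:
  assumes f: "\<And>v. f v \<in> borel_measurable (\<mu> v)"
  shows "sq (U f) = sq f"
proof -
  define F where "F v u = ennreal ((cmod (lam v))\<^sup>2) *
      (\<integral>\<^sup>+ t. ennreal ((cmod (f u t))\<^sup>2) * inverse (ennreal t) \<partial>(\<mu> v))" for v u
  have "sq f = (\<integral>\<^sup>+ u. \<integral>\<^sup>+ v. F v u \<partial>count_space (Chi E u) \<partial>count_space UNIV)"
    unfolding sq_def F_def using f by (intro nn_integral_cong consistent_nn_integral) measurable
  also have "\<dots> = (\<integral>\<^sup>+ u. \<integral>\<^sup>+ v. F v u * indicator (Chi E u) v \<partial>count_space UNIV \<partial>count_space UNIV)"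
    by (intro nn_integral_cong) (simp add: nn_integral_count_space_indicator)
  also have "\<dots> = (\<integral>\<^sup>+ v. \<integral>\<^sup>+ u. F v u * indicator (Chi E u) v \<partial>count_space UNIV \<partial>count_space UNIV)"
    using nn_integral_fst_count_space[of "\<lambda>(u, v). F v u * indicator (Chi E u) v"]
      nn_integral_snd_count_space[of "\<lambda>(u, v). F v u * indicator (Chi E u) v"] by simp
  also have "\<dots> = (\<integral>\<^sup>+ v. F v (par E v) \<partial>count_space UNIV)"
  proof (intro nn_integral_cong)
    fix v
    have "(\<integral>\<^sup>+ u. F v u * indicator (Chi E u) v \<partial>count_space UNIV) =
        (\<Sum>u\<in>{par E v}. F v u * indicator (Chi E u) v)"
      by (rule nn_integral_count_space') (auto simp: Chi_def edge_iff)
    then show "(\<integral>\<^sup>+ u. F v u * indicator (Chi E u) v \<partial>count_space UNIV) = F v (par E v)"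
      by (simp add: Chi_def edge_iff)
  qed
  also have "\<dots> = sq (U f)"
    unfolding sq_def
  proof (intro nn_integral_cong)
    fix v
    have [measurable]: "f (par E v) \<in> borel_measurable (\<mu> v)"
      using f measurable_\<mu>_cong by blast
    have "F v (par E v) = (\<integral>\<^sup>+ t. ennreal ((cmod (lam v))\<^sup>2) * (ennreal ((cmod (f (par E v) t))\<^sup>2) * inverse (ennreal t)) \<partial>(\<mu> v))"
      unfolding F_def by (rule nn_integral_cmult[symmetric]) measurable
    also have "\<dots> = (\<integral>\<^sup>+ t. ennreal ((cmod (U f v t))\<^sup>2) \<partial>(\<mu> v))"
      using AE_pos[of v]
    proof (intro nn_integral_cong_AE, eventually_elim)
      case (elim t)
      have "(cmod (complex_of_real (1 / sqrt t)))\<^sup>2 = inverse t"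
        unfolding norm_of_real power2_abs power_divide using elim by (simp add: divide_inverse)
      then have "(cmod (U f v t))\<^sup>2 = (cmod (lam v))\<^sup>2 * ((cmod (f (par E v) t))\<^sup>2 * inverse t)"
        unfolding isometric_part_def norm_mult power_mult_distrib by simp
      then show ?case using elim by (simp add: ennreal_mult inverse_ennreal)
    qed
    finally show "F v (par E v) = (\<integral>\<^sup>+ t. ennreal ((cmod (U f v t))\<^sup>2) \<partial>(\<mu> v))" .
  qed
  finally show ?thesis by simp
qed

lemma U_K_op: "K_op U"
  unfolding K_op_def
proof (intro conjI ballI allI)
  fix f assume f: "f \<in> K"
  then show "U f \<in> K" "sq (U f) \<le> sq f"
    using sq_U[of f] U_measurable[of f] by (auto simp: K_def)
qed (auto simp: isometric_part_def fun_eq_iff algebra_simps)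

lemma sq_const: "sq (\<lambda>v t. f v) = (\<integral>\<^sup>+ v. ennreal ((cmod (f v))\<^sup>2) \<partial>count_space UNIV)"
  unfolding sq_def
proof (intro nn_integral_cong)
  fix v
  interpret prob_space "\<mu> v" by (rule prob)
  show "(\<integral>\<^sup>+ t. ennreal ((cmod (f v))\<^sup>2) \<partial>\<mu> v) = ennreal ((cmod (f v))\<^sup>2)"
    by (simp add: emeasure_space_1)
qed

lemma const_K: "f \<in> l2 \<Longrightarrow> (\<lambda>v t. f v) \<in> K"
  by (simp add: K_def sq_const l2_iff_nn)

lemma norm_Psi_const:
  assumes "f \<in> l2"
  shows "l2_norm (Psi (\<lambda>v t. f v)) = l2_norm f"
proof -
  have "ennreal ((l2_norm (Psi (\<lambda>v t. f v)))\<^sup>2) = ennreal ((l2_norm f)\<^sup>2)"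
    unfolding Psi_norm[OF const_K[OF assms]] sq_const l2_norm_nn[OF assms] ..
  then have "(l2_norm (Psi (\<lambda>v t. f v)))\<^sup>2 = (l2_norm f)\<^sup>2" by (subst (asm) ennreal_inj) simp_all
  then show ?thesis by (rule power2_eq_imp_eq) simp_all
qed

lemma subnormal_shift:
  assumes dense: "l2_dense (shift_dom E lam)"
  shows "subnormal (shift_dom E lam) (shift_op E lam)"
proof -
  define k where "k t = 1 / sqrt (1 + t)" for t :: real
  define r where "r t = sqrt t / sqrt (1 + t)" for t :: real
  have k: "symbol 1 k" and r: "symbol 1 r"
    unfolding symbol_def k_def[abs_def] r_def[abs_def] space_\<mu>
    by (auto intro!: borel_measurable_\<mu> simp: divide_le_eq)
  have k_pos: "\<forall>v. \<forall>t\<in>space (\<mu> v). 0 < k t"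
    by (simp add: k_def space_\<mu>)
  have kr: "\<forall>v. \<forall>t\<in>space (\<mu> v). (k t)\<^sup>2 + (r t)\<^sup>2 = 1"
    by (simp add: k_def r_def space_\<mu> power_divide add_divide_distrib[symmetric])
  have comm: "U (mult m f) = mult m (U f)" for m f
    by (simp add: isometric_part_def mult_def fun_eq_iff)
  have iso: "\<forall>f\<in>K. sq (U f) = sq f"
    using sq_U by (simp add: K_def)
  obtain D N where N: "normal_op D N"
    "\<And>f. f \<in> K \<Longrightarrow> l2_join (Psi (mult k f)) (\<lambda>_. 0) \<in> D \<and>
       N (l2_join (Psi (mult k f)) (\<lambda>_. 0)) = l2_join (Psi (U (mult r f))) (\<lambda>_. 0)"
    using normal_extension[OF U_K_op iso comm k r k_pos kr] by blast
  define J where "J f = l2_join (Psi (\<lambda>v t. f v)) (\<lambda>_. 0)" for f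
  have J_lin: "op_linear l2 J"
    unfolding op_linear_def
  proof (intro conjI ballI allI)
    show "J ` l2 \<subseteq> l2" by (auto simp: J_def const_K)
    fix f g :: "'a \<Rightarrow> complex" assume fg: "f \<in> l2" "g \<in> l2"
    show "J (\<lambda>i. f i + g i) = (\<lambda>j. J f j + J g j)"
      unfolding J_def Psi_add[OF const_K[OF fg(1)] const_K[OF fg(2)]]
      by (auto simp: l2_join_def)
  next
    fix c and f :: "'a \<Rightarrow> complex"
    show "J (\<lambda>i. c * f i) = (\<lambda>j. c * J f j)"
      unfolding J_def Psi_scale by (auto simp: l2_join_def)
  qed
  have J_norm: "l2_norm (J f) = l2_norm f" if f: "f \<in> l2" for f
  proof -
    have "(l2_norm (J f))\<^sup>2 = (l2_norm f)\<^sup>2"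
      unfolding J_def using f by (simp add: l2_norm_join const_K norm_Psi_const) (simp add: l2_norm_def)
    then show ?thesis by (rule power2_eq_imp_eq) simp_all
  qed
  have ext: "J f \<in> D \<and> N (J f) = J (shift_op E lam f)" if fD: "f \<in> shift_dom E lam" for f
  proof -
    define Sf where "Sf = shift_op E lam f"
    have f: "f \<in> l2" and Sf: "Sf \<in> l2"
      using fD unfolding shift_dom_def Sf_def shift_op_def by auto
    define h where "h v t = of_real (sqrt t) * f v" for v :: 'a and t
    have h_meas: "h v \<in> borel_measurable (\<mu> v)" for v
      unfolding h_def[abs_def] by (rule borel_measurable_\<mu>) measurable
    have Uh: "AE t in \<mu> v. U h v t = Sf v" for v
      using AE_pos[of v]
    proof eventually_elim
      case (elim t)
      then show ?case by (simp add: isometric_part_def h_def Sf_def shift_op_def)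
    qed
    have "sq h = sq (U h)" by (rule sq_U[OF h_meas, symmetric])
    also have "\<dots> = sq (\<lambda>v t. Sf v)"
      unfolding sq_def
    proof (rule nn_integral_cong, rule nn_integral_cong_AE)
      show "AE t in \<mu> v. ennreal ((cmod (U h v t))\<^sup>2) = ennreal ((cmod (Sf v))\<^sup>2)" for v
        using Uh[of v] by eventually_elim simp
    qed
    also have "\<dots> < \<infinity>" using const_K[OF Sf] by (simp add: K_def)
    finally have h: "h \<in> K" using h_meas by (simp add: K_def)
    define g where "g v t = of_real (sqrt (1 + t)) * f v" for v :: 'a and t
    have g: "g \<in> K"
    proof -
      have "sq g \<le> sq (\<lambda>v t. of_real (1 + sqrt t) * f v)"
      proof (rule sq_mono)
        fix v t assume "t \<in> space (\<mu> v)"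
        then have t: "t \<ge> 0" by (simp add: space_\<mu>)
        have "sqrt (1 + t) \<le> 1 + sqrt t" using sqrt_add_le_add_sqrt[of 1 t] t by simp
        then show "cmod (g v t) \<le> cmod (of_real (1 + sqrt t) * f v)"
          unfolding g_def norm_mult norm_of_real using t by (intro mult_right_mono) simp_all
      qed
      also have "(\<lambda>v t. of_real (1 + sqrt t) * f v) = (\<lambda>v t. f v + h v t)"
        by (simp add: h_def algebra_simps)
      also have "sq (\<lambda>v t. f v + h v t) < \<infinity>"
        using K_add[OF const_K[OF f] h] by (simp add: K_def)
      finally show ?thesis
        unfolding K_def g_def[abs_def] by (auto intro!: borel_measurable_\<mu>)
    qed
    have "Psi (mult k g) = Psi (\<lambda>v t. f v)"
    proof (rule Psi_cong_space[OF mult_K[OF k g] const_K[OF f]])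
      fix v t assume "t \<in> space (\<mu> v)"
      then have "t \<ge> 0" by (simp add: space_\<mu>)
      then have "k t * sqrt (1 + t) = 1" by (simp add: k_def)
      then have "complex_of_real (k t * sqrt (1 + t)) = 1" by simp
      then show "mult k g v t = f v" by (simp add: mult_def g_def mult.assoc[symmetric])
    qed
    moreover have "Psi (U (mult r g)) = Psi (\<lambda>v t. Sf v)"
    proof (rule Psi_cong_AE[OF K_opD(1)[OF U_K_op mult_K[OF r g]] const_K[OF Sf]])
      fix v
      show "AE t in \<mu> v. U (mult r g) v t = Sf v"
        using Uh[of v] AE_pos[of v]
      proof eventually_elim
        case (elim t)
        have "r t * sqrt (1 + t) = sqrt t" using elim by (simp add: r_def)
        then have "mult r g w t = h w t" for w
          by (simp add: mult_def g_def h_def mult.assoc[symmetric] flip: of_real_mult)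
        then show ?case using elim by (simp add: isometric_part_def)
      qed
    qed
    ultimately show ?thesis using N(2)[OF g] unfolding J_def Sf_def by simp
  qed
  show ?thesis
    unfolding subnormal_def using dense J_lin J_norm N(1) ext
    by (intro conjI exI[of _ J] exI[of _ D] exI[of _ N]) auto
qed

end

theorem theorem47:
  fixes E :: "('a \<times> 'a) set"
    and lam :: "'a \<Rightarrow> complex"
    and \<mu> :: "'a \<Rightarrow> real measure"
  assumes "directed_tree E" and "rootless E" and "leafless E"
    and "l2_dense (shift_dom E lam)"
    and "\<forall>v. lam v \<noteq> 0"
    and "\<forall>v. prob_space (\<mu> v) \<and> sets (\<mu> v) = sets (restrict_space borel {0::real..})"
    and "\<forall>u. \<forall>\<sigma> \<in> sets (restrict_space borel {0::real..}).
           emeasure (\<mu> u) \<sigma> =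
             (\<integral>\<^sup>+ v. ennreal ((cmod (lam v))\<^sup>2) *
                  (\<integral>\<^sup>+ t. indicator \<sigma> t * inverse (ennreal t) \<partial>(\<mu> v)) \<partial>count_space (Chi E u))"
  shows "subnormal (shift_dom E lam) (shift_op E lam)"
proof -
  obtain A :: "nat \<Rightarrow> real set" where A: "Int_stable (range A)" "{0..} \<in> range A"
    "sets (restrict_space borel {0..}) = sigma_sets {0..} (range A)"
    by (rule countable_generator_nonneg_reals)
  interpret consistent_tree E lam \<mu> A
    by (rule consistent_tree.intro) (use assms A in blast)+
  show ?thesis by (rule subnormal_shift[OF assms(4)])
qed

end
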